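(* Let $Q,R,X,Y$ be nonzero integers and suppose that the group $G=\langle a,b,t\mid a^Q=b^R,\ tb^Xt^{-1}=b^Y\rangle$ is 2-generated. Then there is an epimorphism from $G$ onto $BS(QX,QY)$ if and only if at least one of the greatest common divisors $X\wedge QY$, $Y\wedge QX$, $Q\wedge R$ equals $1$.
   Context: For nonzero integers $m,n$, $BS(m,n)=\langle a,t\mid ta^mt^{-1}=a^n\rangle$. For nonzero integers $m,n$, $m\wedge n>0$ denotes their greatest common divisor (regardless of signs). A group is 2-generated if it can be generated by two elements. *)

theory Defs
  imports "HOL-Algebra.Generated_Groups"
begin

text \<open>
  Group presentations. The generators are the elements of a type \<open>'a\<close>; a letter \<open>(x, True)\<close>
  stands for \<open>x\<close> and \<open>(x, False)\<close> for its formal inverse. A relation \<open>u = v\<close> is the pair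
  \<open>(u, v)\<close>, and the presented group consists of all words modulo the congruence generated by
  free cancellation and the relations. The lemmas below record that this is a group generated by
  the generators, and that it has the universal property of a presentation.
\<close>

type_synonym 'a gword = "('a \<times> bool) list"

inductive pres_eq :: "('a gword \<times> 'a gword) set \<Rightarrow> 'a gword \<Rightarrow> 'a gword \<Rightarrow> bool"
  for Rel where
  refl: "pres_eq Rel u u"
| sym: "pres_eq Rel u v \<Longrightarrow> pres_eq Rel v u"
| trans: "pres_eq Rel u v \<Longrightarrow> pres_eq Rel v w \<Longrightarrow> pres_eq Rel u w"
| cancel: "pres_eq Rel (u @ [(x, s), (x, \<not> s)] @ v) (u @ v)"
| rel: "(l, r) \<in> Rel \<Longrightarrow> pres_eq Rel (u @ l @ v) (u @ r @ v)"

definition word_class :: "('a gword \<times> 'a gword) set \<Rightarrow> 'a gword \<Rightarrow> 'a gword set" where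
  "word_class Rel u = {v. pres_eq Rel u v}"

definition presented_group :: "('a gword \<times> 'a gword) set \<Rightarrow> 'a gword set monoid" where
  "presented_group Rel =
     \<lparr>carrier = range (word_class Rel),
      mult = (\<lambda>A B. \<Union>u\<in>A. \<Union>v\<in>B. word_class Rel (u @ v)),
      one = word_class Rel []\<rparr>"

definition gen_pow :: "'a \<Rightarrow> int \<Rightarrow> 'a gword" where
  "gen_pow x k = replicate (nat \<bar>k\<bar>) (x, 0 \<le> k)"

datatype bs_gen = BS_a | BS_t

definition BS :: "int \<Rightarrow> int \<Rightarrow> bs_gen gword set monoid" where
  "BS m n = presented_group
     {(gen_pow BS_t 1 @ gen_pow BS_a m @ gen_pow BS_t (-1), gen_pow BS_a n)}"

datatype lolli_gen = Gen_a | Gen_b | Gen_t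

definition lollipop_group :: "int \<Rightarrow> int \<Rightarrow> int \<Rightarrow> int \<Rightarrow> lolli_gen gword set monoid" where
  "lollipop_group Q R X Y = presented_group
     {(gen_pow Gen_a Q, gen_pow Gen_b R),
      (gen_pow Gen_t 1 @ gen_pow Gen_b X @ gen_pow Gen_t (-1), gen_pow Gen_b Y)}"

text \<open>The two elements need not be distinct, so cyclic groups are 2-generated.\<close>

definition two_generated :: "('a, 'b) monoid_scheme \<Rightarrow> bool" where
  "two_generated G \<longleftrightarrow>
     (\<exists>x\<in>carrier G. \<exists>y\<in>carrier G. generate G {x, y} = carrier G)"


lemma pres_eq_append:
  assumes "pres_eq Rel u u'" "pres_eq Rel v v'"
  shows "pres_eq Rel (u @ v) (u' @ v')"
proof -
  have left: "pres_eq Rel (w @ u) (w @ u')" if "pres_eq Rel u u'" for w u u'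
    using that
  proof induction
    case (cancel u x s v)
    then show ?case using pres_eq.cancel[of Rel "w @ u" x s v] by simp
  next
    case (rel l r u v)
    then show ?case using pres_eq.rel[of l r Rel "w @ u" v] by simp
  next
    case sym
    then show ?case by (blast intro: pres_eq.sym)
  next
    case trans
    then show ?case by (blast intro: pres_eq.trans)
  qed (rule pres_eq.refl)
  have right: "pres_eq Rel (u @ w) (u' @ w)" if "pres_eq Rel u u'" for w u u'
    using that
  proof induction
    case (cancel u x s v)
    then show ?case using pres_eq.cancel[of Rel u x s "v @ w"] by simp
  next
    case (rel l r u v)
    then show ?case using pres_eq.rel[of l r Rel u "v @ w"] by simp
  next
    case sym
    then show ?case by (blast intro: pres_eq.sym)
  next
    case trans
    then show ?case by (blast intro: pres_eq.trans)
  qed (rule pres_eq.refl)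
  show ?thesis
    by (rule pres_eq.trans[OF right[OF assms(1)] left[OF assms(2)]])
qed

lemma word_class_eq_iff: "word_class Rel u = word_class Rel v \<longleftrightarrow> pres_eq Rel u v"
proof
  assume "word_class Rel u = word_class Rel v"
  moreover have "v \<in> word_class Rel v" by (simp add: word_class_def pres_eq.refl)
  ultimately show "pres_eq Rel u v" by (simp add: word_class_def set_eq_iff)
next
  assume uv: "pres_eq Rel u v"
  have "pres_eq Rel u w \<longleftrightarrow> pres_eq Rel v w" for w
    by (rule iffI) (erule pres_eq.trans[OF pres_eq.sym[OF uv]], erule pres_eq.trans[OF uv])
  then show "word_class Rel u = word_class Rel v"
    by (simp add: word_class_def)
qed

lemma carrier_presented_group: "carrier (presented_group Rel) = range (word_class Rel)"
  by (simp add: presented_group_def)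

lemma one_presented_group: "\<one>\<^bsub>presented_group Rel\<^esub> = word_class Rel []"
  by (simp add: presented_group_def)

lemma mult_presented_group:
  "word_class Rel u \<otimes>\<^bsub>presented_group Rel\<^esub> word_class Rel v = word_class Rel (u @ v)"
proof -
  have "word_class Rel (u' @ v') = word_class Rel (u @ v)"
    if "u' \<in> word_class Rel u" "v' \<in> word_class Rel v" for u' v'
  proof -
    have "pres_eq Rel (u @ v) (u' @ v')"
      using that by (intro pres_eq_append) (simp_all add: word_class_def)
    then show ?thesis
      by (simp add: word_class_eq_iff pres_eq.sym)
  qed
  then have "(\<Union>u'\<in>word_class Rel u. \<Union>v'\<in>word_class Rel v. word_class Rel (u' @ v')) =
      (\<Union>u'\<in>word_class Rel u. \<Union>v'\<in>word_class Rel v. word_class Rel (u @ v))"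
    by (intro SUP_cong HOL.refl)
  moreover have "u \<in> word_class Rel u" "v \<in> word_class Rel v"
    by (simp_all add: word_class_def pres_eq.refl)
  then have "word_class Rel u \<noteq> {}" "word_class Rel v \<noteq> {}" by blast+
  ultimately show ?thesis
    by (simp add: presented_group_def)
qed

definition inv_word :: "'a gword \<Rightarrow> 'a gword" where
  "inv_word w = rev (map (\<lambda>(x, s). (x, \<not> s)) w)"

lemma pres_eq_inv_word: "pres_eq Rel (inv_word w @ w) []"
proof (induction w)
  case Nil
  then show ?case by (simp add: inv_word_def pres_eq.refl)
next
  case (Cons p w)
  obtain x s where p: "p = (x, s)" by (cases p)
  have "pres_eq Rel (inv_word w @ [(x, \<not> s), (x, \<not> \<not> s)] @ w) (inv_word w @ w)"
    by (rule pres_eq.cancel)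
  moreover have "inv_word (p # w) @ p # w = inv_word w @ [(x, \<not> s), (x, \<not> \<not> s)] @ w"
    by (simp add: inv_word_def p)
  ultimately show ?case
    using Cons.IH pres_eq.trans by metis
qed

lemma group_presented_group: "group (presented_group Rel)"
proof (rule groupI)
  show "\<exists>y\<in>carrier (presented_group Rel). y \<otimes>\<^bsub>presented_group Rel\<^esub> x = \<one>\<^bsub>presented_group Rel\<^esub>"
    if x: "x \<in> carrier (presented_group Rel)" for x
  proof -
    obtain w where "x = word_class Rel w"
      using x by (auto simp: carrier_presented_group)
    then have "word_class Rel (inv_word w) \<otimes>\<^bsub>presented_group Rel\<^esub> x = \<one>\<^bsub>presented_group Rel\<^esub>"
      by (simp add: mult_presented_group one_presented_group word_class_eq_iff pres_eq_inv_word)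
    then show ?thesis by (auto simp: carrier_presented_group)
  qed
qed (auto simp: carrier_presented_group one_presented_group mult_presented_group)

lemma inv_presented_group:
  "inv\<^bsub>presented_group Rel\<^esub> word_class Rel w = word_class Rel (inv_word w)"
  by (rule group.inv_equality[OF group_presented_group])
     (auto simp: carrier_presented_group one_presented_group mult_presented_group
        word_class_eq_iff pres_eq_inv_word)

lemma word_class_gen_pow:
  "word_class Rel (gen_pow x k) = word_class Rel [(x, True)] [^]\<^bsub>presented_group Rel\<^esub> k"
proof -
  interpret group "presented_group Rel" by (rule group_presented_group)
  have c: "word_class Rel w \<in> carrier (presented_group Rel)" for w
    by (simp add: carrier_presented_group)
  have rep: "word_class Rel (replicate n l) = word_class Rel [l] [^]\<^bsub>presented_group Rel\<^esub> n"
    for n :: nat and l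
  proof (induction n)
    case 0
    then show ?case by (simp add: one_presented_group)
  next
    case (Suc n)
    have "word_class Rel (replicate (Suc n) l)
        = word_class Rel (replicate n l) \<otimes>\<^bsub>presented_group Rel\<^esub> word_class Rel [l]"
      by (simp add: mult_presented_group replicate_append_same)
    then show ?case using Suc by simp
  qed
  have i: "word_class Rel [(x, False)] = inv\<^bsub>presented_group Rel\<^esub> word_class Rel [(x, True)]"
    by (simp add: inv_presented_group inv_word_def)
  show ?thesis
  proof (cases "0 \<le> k")
    case True
    then show ?thesis
      unfolding gen_pow_def int_pow_def2 rep by simp
  next
    case False
    then show ?thesis
      unfolding gen_pow_def int_pow_def2 rep
      by (simp add: i nat_pow_inv[OF c])
  qed
qed

lemma generate_presented_group:
  "generate (presented_group Rel) (range (\<lambda>x. word_class Rel [(x, True)])) =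
     carrier (presented_group Rel)" (is "generate ?G ?S = _")
proof
  interpret group ?G by (rule group_presented_group)
  show "generate ?G ?S \<subseteq> carrier ?G"
    by (rule generate_incl) (auto simp: carrier_presented_group)
  have "word_class Rel w \<in> generate ?G ?S" for w
  proof (induction w)
    case Nil
    then show ?case using generate.one[of ?G ?S] by (simp add: one_presented_group)
  next
    case (Cons p w)
    obtain x s where p: "p = (x, s)" by (cases p)
    have "word_class Rel [(x, False)] = inv\<^bsub>?G\<^esub> word_class Rel [(x, True)]"
      by (simp add: inv_presented_group inv_word_def)
    then have "word_class Rel [p] \<in> generate ?G ?S"
      by (cases s) (auto simp: p intro: generate.incl generate.inv)
    then have "word_class Rel [p] \<otimes>\<^bsub>?G\<^esub> word_class Rel w \<in> generate ?G ?S"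
      using Cons.IH by (rule generate.eng)
    then show ?case by (simp add: mult_presented_group)
  qed
  then show "carrier ?G \<subseteq> generate ?G ?S"
    by (auto simp: carrier_presented_group)
qed

primrec word_eval :: "('b, 'c) monoid_scheme \<Rightarrow> ('a \<Rightarrow> 'b) \<Rightarrow> 'a gword \<Rightarrow> 'b" where
  "word_eval H f [] = \<one>\<^bsub>H\<^esub>"
| "word_eval H f (p # w) =
     (if snd p then f (fst p) else inv\<^bsub>H\<^esub> f (fst p)) \<otimes>\<^bsub>H\<^esub> word_eval H f w"

lemma presented_group_universal:
  assumes H: "group H" and f: "\<And>x. f x \<in> carrier H"
    and Rel: "\<And>u v. (u, v) \<in> Rel \<Longrightarrow> word_eval H f u = word_eval H f v"
  shows "\<exists>h\<in>hom (presented_group Rel) H. \<forall>w. h (word_class Rel w) = word_eval H f w"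
proof -
  interpret H: group H by fact
  have c: "word_eval H f w \<in> carrier H" for w
    by (induction w) (auto simp: f)
  have app: "word_eval H f (u @ v) = word_eval H f u \<otimes>\<^bsub>H\<^esub> word_eval H f v" for u v
    by (induction u) (auto simp: f c H.m_assoc)
  have eq: "word_eval H f u = word_eval H f v" if "pres_eq Rel u v" for u v
    using that
  proof induction
    case (cancel u x s v)
    have "word_eval H f [(x, s), (x, \<not> s)] = \<one>\<^bsub>H\<^esub>"
      by (cases s) (auto simp: f)
    then show ?case by (simp only: app) (simp add: c)
  next
    case (rel l r u v)
    then show ?case by (simp add: app Rel)
  qed auto
  define h where "h A = word_eval H f (SOME w. w \<in> A)" for A
  have h: "h (word_class Rel w) = word_eval H f w" for w
  proof -
    have "w \<in> word_class Rel w" by (simp add: word_class_def pres_eq.refl)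
    then have "(SOME v. v \<in> word_class Rel w) \<in> word_class Rel w" by (rule someI)
    then show ?thesis unfolding h_def using eq by (simp add: word_class_def)
  qed
  have "h \<in> hom (presented_group Rel) H"
    by (rule homI) (auto simp: carrier_presented_group mult_presented_group h c app)
  then show ?thesis using h by blast
qed

end

theory Submission
  imports Defs "HOL-Algebra.Product_Groups" "HOL-Number_Theory.Residues"
begin

text \<open>
  Call \<open>a, b, t\<close> in a group a lollipop triple if they satisfy the two relations of the lollipop
  group. By the universal property, an epimorphism onto a group \<open>H\<close> is the same as a lollipop triple
  that generates \<open>H\<close>. Write \<open>\<alpha>, \<tau>\<close> for the generators of \<open>BS (QX) (QY)\<close>.

  Existence. If \<open>Q\<close> and \<open>R\<close> are coprime, the triple \<open>\<alpha>\<^sup>R, \<alpha>\<^sup>Q, \<tau>\<close> generates. Suppose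
  \<open>X\<close> is coprime to \<open>QY\<close> and every common prime of \<open>Q\<close> and \<open>R\<close> divides \<open>Y\<close>. Split \<open>R\<close> as \<open>r1 r2\<close>
  with \<open>r1\<close> coprime to \<open>Y\<close> and \<open>r2 s = Y\<^sup>k\<close>. Then \<open>b = \<alpha>\<^bsup>Qs\<^esup>\<close> satisfies
  \<open>b\<^sup>R = \<alpha>\<^bsup>Q Y^k r1\<^esup>\<close>, which \<open>\<tau>\<^sup>k\<close> conjugates back to \<open>\<alpha>\<^bsup>Q X^k r1\<^esup>\<close>, so
  \<open>a = \<tau>\<^sup>k \<alpha>\<^bsup>X^k r1\<^esup> \<tau>\<^bsup>-k\<^esup>\<close> is a \<open>Q\<close>-th root of it. The exponents \<open>Qs\<close> and
  \<open>X\<^sup>k r1\<close> are coprime, so \<open>a, b, \<tau>\<close> generate. The case of \<open>Y\<close> coprime to \<open>QX\<close> follows by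
  inverting the stable letters.

  The role of two generators. If the lollipop group is generated by two elements, a homomorphism into
  a finite group \<open>S\<close> is determined by two elements of \<open>S\<close>, so \<open>S\<close> has at most \<open>|S|\<^sup>2\<close> lollipop triples.
  Two families of finite groups with more triples than that show, in a two-generated lollipop group:
  every common prime of \<open>Q\<close> and \<open>R\<close> divides \<open>X\<close> or \<open>Y\<close>
  (\<open>not_two_generated_if_no_divisor\<close>), and when \<open>Q\<close> is not a unit, no prime divides all of
  \<open>R, X, Y\<close> (\<open>not_two_generated_if_common_factor\<close>).

  Obstruction. Suppose that none of the three gcds is 1 and that \<open>a, b, t\<close> is a generating triple of
  \<open>BS (QX) (QY)\<close>. Let \<open>p\<close> be a common prime of \<open>Q\<close> and \<open>R\<close>. It divides exactly one of \<open>X, Y\<close>, say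
  \<open>Y\<close>; let \<open>q\<close> be a prime dividing \<open>X\<close> and \<open>QY\<close>. Since \<open>t\<close> conjugates \<open>a\<^bsup>QX\<^esup>\<close> to \<open>a\<^bsup>QY\<^esup>\<close>
  and these exponents differ in absolute value, \<open>a\<close> is elliptic in the Bass-Serre tree, that is, it is
  conjugate to some \<open>\<alpha>\<^sup>i\<close>; conjugate everything so that \<open>a = \<alpha>\<^sup>i\<close>. If \<open>p\<close> or \<open>q\<close>
  divided \<open>i\<close>, then, because \<open>q\<close> does not divide both \<open>R\<close> and \<open>Y\<close>, the triple could not generate the
  abelianization modulo that prime. Therefore neither \<open>QX\<close> nor \<open>QY\<close> divides \<open>iQ\<close>, which means
  that \<open>\<alpha>\<^bsup>iQ\<^esup>\<close> fixes only one vertex of the tree. As \<open>b\<close> commutes with \<open>b\<^sup>R = \<alpha>\<^bsup>iQ\<^esup>\<close>, it fixes that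
  vertex, so \<open>b = \<alpha>\<^sup>j\<close> with \<open>iQ = jR\<close>. Comparing powers of \<open>p\<close>, \<open>Q\<close> does not divide \<open>jX\<close>, so
  \<open>\<alpha>\<^bsup>jX\<^esup>\<close> also fixes only one vertex and \<open>t\<close> is a power of \<open>\<alpha>\<close> as well. Then \<open>t\<close> commutes with \<open>b\<close>,
  which forces \<open>jX = jY\<close>, hence \<open>j = 0\<close> and \<open>i = 0\<close>, a contradiction.

  The facts about the tree (\<open>elliptic_if_pow_conj\<close>, \<open>mem_\<alpha>_if_conj_\<alpha>\<close>) are proved with
  normal forms, on which the words act.
\<close>

section \<open>Lollipop triples and homomorphisms\<close>

definition lollipop_triple where
  "lollipop_triple H Q R X Y a b t \<longleftrightarrow>
     a \<in> carrier H \<and> b \<in> carrier H \<and> t \<in> carrier H \<and>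
     a [^]\<^bsub>H\<^esub> (Q :: int) = b [^]\<^bsub>H\<^esub> (R :: int) \<and>
     t \<otimes>\<^bsub>H\<^esub> b [^]\<^bsub>H\<^esub> (X :: int) \<otimes>\<^bsub>H\<^esub> inv\<^bsub>H\<^esub> t = b [^]\<^bsub>H\<^esub> (Y :: int)"

lemma (in group) conj_eq_iff:
  assumes "t \<in> carrier G" "x \<in> carrier G" "y \<in> carrier G"
  shows "t \<otimes> x \<otimes> inv t = y \<longleftrightarrow> t \<otimes> x = y \<otimes> t"
  using inv_solve_right'[of y "t \<otimes> x" t] assms by auto

lemma (in group) lollipop_tripleI:
  assumes "a \<in> carrier G" "b \<in> carrier G" "t \<in> carrier G"
    "a [^] Q = b [^] R" "t \<otimes> b [^] X = b [^] Y \<otimes> t"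
  shows "lollipop_triple G Q R X Y a b t"
  unfolding lollipop_triple_def
  using assms conj_eq_iff[of t "b [^] X" "b [^] Y"] by blast

lemma (in group) conj_int_pow:
  assumes "t \<in> carrier G" "x \<in> carrier G"
  shows "(t \<otimes> x \<otimes> inv t) [^] (n :: int) = t \<otimes> x [^] n \<otimes> inv t"
proof -
  have "(\<lambda>x. t \<otimes> x \<otimes> inv t) \<in> hom G G"
    using assms(1) by (auto intro!: homI simp: m_assoc inv_solve_left)
  then show ?thesis
    using hom_int_pow[of "\<lambda>x. t \<otimes> x \<otimes> inv t" G G x n] assms(2) is_group by simp
qed

lemma word_eval_closed:
  assumes "group H" "\<And>x. f x \<in> carrier H"
  shows "word_eval H f w \<in> carrier H"
proof -
  interpret group H by fact
  show ?thesis by (induction w) (auto simp: assms(2))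
qed

lemma word_eval_append:
  assumes "group H" "\<And>x. f x \<in> carrier H"
  shows "word_eval H f (u @ v) = word_eval H f u \<otimes>\<^bsub>H\<^esub> word_eval H f v"
proof -
  interpret group H by fact
  show ?thesis
    by (induction u) (auto simp: assms(2) word_eval_closed[OF assms] m_assoc)
qed

lemma word_eval_gen_pow:
  assumes "group H" "\<And>x. f x \<in> carrier H"
  shows "word_eval H f (gen_pow x k) = f x [^]\<^bsub>H\<^esub> k"
proof -
  interpret group H by fact
  have pos: "word_eval H f (replicate n (x, True)) = f x [^]\<^bsub>H\<^esub> n"
    and neg: "word_eval H f (replicate n (x, False)) = (inv\<^bsub>H\<^esub> f x) [^]\<^bsub>H\<^esub> n" for n :: nat
    by (induction n) (auto simp: assms(2) nat_pow_Suc2 simp del: nat_pow_Suc Group.nat_pow_Suc)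
  show ?thesis
  proof (cases "0 \<le> k")
    case True
    then show ?thesis
      unfolding gen_pow_def int_pow_def2 by (simp add: pos)
  next
    case False
    then show ?thesis
      unfolding gen_pow_def int_pow_def2 by (simp add: neg nat_pow_inv[OF assms(2)])
  qed
qed

lemma hom_eq_on_generate:
  assumes "group G" "group H" "h \<in> hom G H" "k \<in> hom G H" "S \<subseteq> carrier G"
    and eq: "\<And>x. x \<in> S \<Longrightarrow> h x = k x" and x: "x \<in> generate G S"
  shows "h x = k x"
proof -
  interpret G: group G by fact
  interpret h: group_hom G H h
    by (rule group_hom.intro[OF assms(1,2)]) (simp add: group_hom_axioms_def assms(3))
  interpret k: group_hom G H k
    by (rule group_hom.intro[OF assms(1,2)]) (simp add: group_hom_axioms_def assms(4))
  show ?thesis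
    using x
  proof induction
    case (eng x y)
    then show ?case
      using G.generate_in_carrier[OF assms(5)] by simp
  next
    case (inv x)
    then show ?case using assms(5) eq[of x] h.hom_inv[of x] k.hom_inv[of x] by auto
  qed (auto simp: eq)
qed

abbreviation lolli_elem :: "int \<Rightarrow> int \<Rightarrow> int \<Rightarrow> int \<Rightarrow> lolli_gen \<Rightarrow> lolli_gen gword set" where
  "lolli_elem Q R X Y x \<equiv> word_class
     {(gen_pow Gen_a Q, gen_pow Gen_b R),
      (gen_pow Gen_t 1 @ gen_pow Gen_b X @ gen_pow Gen_t (-1), gen_pow Gen_b Y)} [(x, True)]"

lemma group_lollipop_group: "group (lollipop_group Q R X Y)"
  by (simp add: lollipop_group_def group_presented_group)

lemma lolli_elem_closed: "lolli_elem Q R X Y x \<in> carrier (lollipop_group Q R X Y)"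
  by (simp add: lollipop_group_def carrier_presented_group)

lemma generate_lollipop_group:
  "generate (lollipop_group Q R X Y)
     {lolli_elem Q R X Y Gen_a, lolli_elem Q R X Y Gen_b, lolli_elem Q R X Y Gen_t}
   = carrier (lollipop_group Q R X Y)"
proof -
  have UNIV: "UNIV = {Gen_a, Gen_b, Gen_t}"
    using lolli_gen.exhaust by blast
  have "range (lolli_elem Q R X Y) =
      {lolli_elem Q R X Y Gen_a, lolli_elem Q R X Y Gen_b, lolli_elem Q R X Y Gen_t}"
    by (simp add: UNIV)
  then show ?thesis
    using generate_presented_group[of "{(gen_pow Gen_a Q, gen_pow Gen_b R),
      (gen_pow Gen_t 1 @ gen_pow Gen_b X @ gen_pow Gen_t (-1), gen_pow Gen_b Y)}"]
    by (simp add: lollipop_group_def)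
qed

lemma word_class_conj_pow:
  "word_class Rel (gen_pow t 1 @ gen_pow b k @ gen_pow t (-1)) =
     word_class Rel [(t, True)] \<otimes>\<^bsub>presented_group Rel\<^esub>
     word_class Rel [(b, True)] [^]\<^bsub>presented_group Rel\<^esub> k \<otimes>\<^bsub>presented_group Rel\<^esub>
     inv\<^bsub>presented_group Rel\<^esub> word_class Rel [(t, True)]"
proof -
  interpret group "presented_group Rel" by (rule group_presented_group)
  have c: "word_class Rel w \<in> carrier (presented_group Rel)" for w
    by (simp add: carrier_presented_group)
  show ?thesis
    by (simp only: mult_presented_group[symmetric] word_class_gen_pow)
       (simp add: c int_pow_neg m_assoc)
qed

lemma word_class_rel:
  assumes "(l, r) \<in> Rel"
  shows "word_class Rel l = word_class Rel r"
  using pres_eq.rel[OF assms, of "[]" "[]"] by (simp add: word_class_eq_iff)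

lemma lollipop_triple_generators:
  "lollipop_triple (lollipop_group Q R X Y) Q R X Y
     (lolli_elem Q R X Y Gen_a) (lolli_elem Q R X Y Gen_b) (lolli_elem Q R X Y Gen_t)"
proof -
  let ?Rel = "{(gen_pow Gen_a Q, gen_pow Gen_b R),
      (gen_pow Gen_t 1 @ gen_pow Gen_b X @ gen_pow Gen_t (-1), gen_pow Gen_b Y)}"
  have "word_class ?Rel (gen_pow Gen_a Q) = word_class ?Rel (gen_pow Gen_b R)"
    "word_class ?Rel (gen_pow Gen_t 1 @ gen_pow Gen_b X @ gen_pow Gen_t (-1))
       = word_class ?Rel (gen_pow Gen_b Y)"
    by (rule word_class_rel, simp)+
  then show ?thesis
    unfolding lollipop_triple_def word_class_conj_pow word_class_gen_pow
    by (simp add: lollipop_group_def carrier_presented_group)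
qed

lemma lollipop_hom_exists:
  assumes H: "group H" and abt: "lollipop_triple H Q R X Y a b t"
  shows "\<exists>h\<in>hom (lollipop_group Q R X Y) H. h (lolli_elem Q R X Y Gen_a) = a \<and>
           h (lolli_elem Q R X Y Gen_b) = b \<and> h (lolli_elem Q R X Y Gen_t) = t"
proof -
  interpret group H by fact
  define f where "f x = (case x of Gen_a \<Rightarrow> a | Gen_b \<Rightarrow> b | Gen_t \<Rightarrow> t)" for x
  have f_simps: "f Gen_a = a" "f Gen_b = b" "f Gen_t = t"
    by (simp_all add: f_def)
  have f: "f x \<in> carrier H" for x
    using abt by (cases x) (auto simp: f_simps lollipop_triple_def)
  have "\<exists>h\<in>hom (lollipop_group Q R X Y) H. \<forall>w. h (word_class
     {(gen_pow Gen_a Q, gen_pow Gen_b R),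
      (gen_pow Gen_t 1 @ gen_pow Gen_b X @ gen_pow Gen_t (-1), gen_pow Gen_b Y)} w) = word_eval H f w"
    unfolding lollipop_group_def
  proof (rule presented_group_universal[OF H f], goal_cases)
    case (1 u v)
    then show ?case
      using abt
      by (auto simp: word_eval_append[OF H f] word_eval_gen_pow[OF H f] f_simps
          lollipop_triple_def m_assoc int_pow_neg)
  qed
  then obtain h where h: "h \<in> hom (lollipop_group Q R X Y) H"
    "\<And>x. h (lolli_elem Q R X Y x) = word_eval H f [(x, True)]"
    by blast
  have "h (lolli_elem Q R X Y x) = f x" for x
    by (simp add: h(2) f)
  then show ?thesis
    using h(1) by (intro bexI[of _ h]) (simp_all add: f_simps)
qed

lemma lollipop_triple_hom:
  assumes "group G" "group H" "h \<in> hom G H" "lollipop_triple G Q R X Y a b t"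
  shows "lollipop_triple H Q R X Y (h a) (h b) (h t)"
proof -
  interpret h: group_hom G H h
    by (rule group_hom.intro[OF assms(1,2)]) (simp add: group_hom_axioms_def assms(3))
  have abt: "a \<in> carrier G" "b \<in> carrier G" "t \<in> carrier G"
    and rels: "a [^]\<^bsub>G\<^esub> Q = b [^]\<^bsub>G\<^esub> R" "t \<otimes>\<^bsub>G\<^esub> b [^]\<^bsub>G\<^esub> X \<otimes>\<^bsub>G\<^esub> inv\<^bsub>G\<^esub> t = b [^]\<^bsub>G\<^esub> Y"
    using assms(4) by (auto simp: lollipop_triple_def)
  have "h (a [^]\<^bsub>G\<^esub> Q) = h (b [^]\<^bsub>G\<^esub> R)"
    "h (t \<otimes>\<^bsub>G\<^esub> b [^]\<^bsub>G\<^esub> X \<otimes>\<^bsub>G\<^esub> inv\<^bsub>G\<^esub> t) = h (b [^]\<^bsub>G\<^esub> Y)"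
    by (simp_all add: rels)
  then show ?thesis
    using abt by (simp add: lollipop_triple_def h.hom_int_pow)
qed

lemma lollipop_epi_iff:
  assumes H: "group H"
  shows "(\<exists>f. f \<in> epi (lollipop_group Q R X Y) H) \<longleftrightarrow>
    (\<exists>a b t. lollipop_triple H Q R X Y a b t \<and> generate H {a, b, t} = carrier H)"
    (is "?L \<longleftrightarrow> ?R")
proof -
  let ?G = "lollipop_group Q R X Y" and ?e = "lolli_elem Q R X Y"
  have img: "generate H {h (?e Gen_a), h (?e Gen_b), h (?e Gen_t)} = h ` carrier ?G"
    if "h \<in> hom ?G H" for h
  proof -
    interpret h: group_hom ?G H h
      by (rule group_hom.intro[OF group_lollipop_group H]) (simp add: group_hom_axioms_def that)
    show ?thesis
      using h.generate_img[of "{?e Gen_a, ?e Gen_b, ?e Gen_t}"]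
      by (simp add: lolli_elem_closed generate_lollipop_group)
  qed
  show ?thesis
  proof
    assume ?L
    then obtain f where f: "f \<in> hom ?G H" "f ` carrier ?G = carrier H"
      by (auto simp: epi_def)
    then show ?R
      using lollipop_triple_hom[OF group_lollipop_group H f(1) lollipop_triple_generators] img[OF f(1)]
      by auto
  next
    assume ?R
    then obtain a b t where abt: "lollipop_triple H Q R X Y a b t" "generate H {a, b, t} = carrier H"
      by blast
    obtain h where h: "h \<in> hom ?G H" "h (?e Gen_a) = a" "h (?e Gen_b) = b" "h (?e Gen_t) = t"
      using lollipop_hom_exists[OF H abt(1)] by blast
    then have "h ` carrier ?G = carrier H" using img[OF h(1)] abt(2) by simp
    then show ?L using h(1) by (auto simp: epi_def)
  qed
qed

text \<open>
  A triple is a homomorphism from the lollipop group, and a homomorphism is determined by the images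
  of two generators.
\<close>

lemma two_generated_card_triples:
  assumes two: "two_generated (lollipop_group Q R X Y)" and S: "group S" "finite (carrier S)"
  shows "card {(a, b, t). lollipop_triple S Q R X Y a b t} \<le> card (carrier S) ^ 2"
proof -
  let ?G = "lollipop_group Q R X Y" and ?e = "lolli_elem Q R X Y"
  let ?T = "{(a, b, t). lollipop_triple S Q R X Y a b t}"
  obtain x y where xy: "x \<in> carrier ?G" "y \<in> carrier ?G" "generate ?G {x, y} = carrier ?G"
    using two unfolding two_generated_def by blast
  have "\<forall>p\<in>?T. \<exists>h. h \<in> hom ?G S \<and> (h (?e Gen_a), h (?e Gen_b), h (?e Gen_t)) = p"
  proof
    fix p assume "p \<in> ?T"
    then obtain a b t where p: "p = (a, b, t)" and abt: "lollipop_triple S Q R X Y a b t"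
      by blast
    obtain h where h: "h \<in> hom ?G S" "h (?e Gen_a) = a" "h (?e Gen_b) = b" "h (?e Gen_t) = t"
      using lollipop_hom_exists[OF S(1) abt] by blast
    then show "\<exists>h. h \<in> hom ?G S \<and> (h (?e Gen_a), h (?e Gen_b), h (?e Gen_t)) = p"
      by (intro exI[of _ h]) (simp add: p)
  qed
  from bchoice[OF this] obtain h where
    "\<forall>p\<in>?T. h p \<in> hom ?G S \<and> (h p (?e Gen_a), h p (?e Gen_b), h p (?e Gen_t)) = p" ..
  then have h: "h p \<in> hom ?G S" "(h p (?e Gen_a), h p (?e Gen_b), h p (?e Gen_t)) = p"
    if "p \<in> ?T" for p
    by (simp_all only: that)
  have "inj_on (\<lambda>p. (h p x, h p y)) ?T"
  proof (rule inj_onI)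
    fix p q assume p: "p \<in> ?T" and q: "q \<in> ?T" and eq: "(h p x, h p y) = (h q x, h q y)"
    have sub: "{x, y} \<subseteq> carrier ?G" using xy(1,2) by blast
    have xy_eq: "h p z = h q z" if "z \<in> {x, y}" for z
      using that eq by blast
    have "h p (?e v) = h q (?e v)" for v
      by (rule hom_eq_on_generate[OF group_lollipop_group S(1) h(1)[OF p] h(1)[OF q] sub xy_eq])
         (simp_all only: xy(3) lolli_elem_closed)
    then have "(h p (?e Gen_a), h p (?e Gen_b), h p (?e Gen_t)) =
        (h q (?e Gen_a), h q (?e Gen_b), h q (?e Gen_t))"
      by simp
    then show "p = q" by (simp only: h(2)[OF p] h(2)[OF q])
  qed
  moreover have "(\<lambda>p. (h p x, h p y)) ` ?T \<subseteq> carrier S \<times> carrier S"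
    using h(1) xy(1,2) by (auto simp: hom_def Pi_iff)
  ultimately have "card ?T \<le> card (carrier S \<times> carrier S)"
    using S(2) by (intro card_inj_on_le) auto
  then show ?thesis by (simp add: card_cartesian_product power2_eq_square)
qed

section \<open>Finite groups with many lollipop triples\<close>

text \<open>
  The semidirect product of \<open>V\<close> with the integers modulo \<open>k\<close>, whose generator acts by \<open>\<sigma>\<close>. It is a
  group as soon as \<open>\<sigma>\<close> is an endomorphism with \<open>\<sigma>\<^sup>k = id\<close>.
\<close>

definition cyclic_extension ::
    "('a, 'b) monoid_scheme \<Rightarrow> ('a \<Rightarrow> 'a) \<Rightarrow> nat \<Rightarrow> ('a \<times> nat) monoid" where
  "cyclic_extension V \<sigma> k =
     \<lparr>carrier = carrier V \<times> {0..<k},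
      monoid.mult = (\<lambda>(v, c) (w, d). (v \<otimes>\<^bsub>V\<^esub> (\<sigma> ^^ c) w, (c + d) mod k)),
      one = (\<one>\<^bsub>V\<^esub>, 0)\<rparr>"

locale cyclic_action = group V for V (structure) +
  fixes \<sigma> :: "'a \<Rightarrow> 'a" and k :: nat
  assumes hom: "\<sigma> \<in> hom V V" and k_pos: "0 < k"
    and period: "\<And>v. v \<in> carrier V \<Longrightarrow> (\<sigma> ^^ k) v = v"
begin

abbreviation "E \<equiv> cyclic_extension V \<sigma> k"

lemma pow_closed: "v \<in> carrier V \<Longrightarrow> (\<sigma> ^^ c) v \<in> carrier V"
  by (induction c) (use hom in \<open>auto simp: hom_def Pi_iff\<close>)

lemma pow_mult: "v \<in> carrier V \<Longrightarrow> w \<in> carrier V \<Longrightarrow> (\<sigma> ^^ c) (v \<otimes> w) = (\<sigma> ^^ c) v \<otimes> (\<sigma> ^^ c) w"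
  by (induction c) (use hom pow_closed in \<open>auto simp: hom_def Pi_iff\<close>)

lemma pow_one: "(\<sigma> ^^ c) \<one> = \<one>"
proof -
  have "\<sigma> \<one> = \<one>" using hom_one[OF hom is_group is_group] .
  then show ?thesis by (induction c) auto
qed

lemma pow_mod: "v \<in> carrier V \<Longrightarrow> (\<sigma> ^^ (c mod k)) v = (\<sigma> ^^ c) v"
proof -
  assume v: "v \<in> carrier V"
  have "(\<sigma> ^^ (k * j)) v = v" for j
    by (induction j) (simp_all add: funpow_add v period)
  then have "(\<sigma> ^^ (c mod k + k * (c div k))) v = (\<sigma> ^^ (c mod k)) v"
    by (simp only: funpow_add o_apply)
  then show ?thesis by simp
qed

lemma carrier_ext: "carrier E = carrier V \<times> {0..<k}"
  by (simp add: cyclic_extension_def)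

lemma one_ext: "\<one>\<^bsub>E\<^esub> = (\<one>, 0)"
  by (simp add: cyclic_extension_def)

lemma mult_ext: "(v, c) \<otimes>\<^bsub>E\<^esub> (w, d) = (v \<otimes> (\<sigma> ^^ c) w, (c + d) mod k)"
  by (simp add: cyclic_extension_def)

lemma shift_nat_pow: "(\<one>, 1 mod k) [^]\<^bsub>E\<^esub> (n :: nat) = (\<one>, n mod k)"
  by (induction n) (simp_all add: one_ext mult_ext pow_one mod_add_eq mod_add_right_eq mod_Suc_eq k_pos)

lemma group_ext: "group E"
proof (rule groupI)
  fix x assume "x \<in> carrier E"
  then obtain v c where x: "x = (v, c)" "v \<in> carrier V" "c < k"
    by (auto simp: carrier_ext)
  define d where "d = (k - c) mod k"
  have d: "(d + c) mod k = 0" using x(3) by (simp add: d_def mod_add_left_eq)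
  have "(inv ((\<sigma> ^^ d) v), d) \<otimes>\<^bsub>E\<^esub> x = \<one>\<^bsub>E\<^esub>"
    using d x by (simp add: mult_ext one_ext pow_closed)
  moreover have "(inv ((\<sigma> ^^ d) v), d) \<in> carrier E"
    using x k_pos by (simp add: carrier_ext pow_closed d_def)
  ultimately show "\<exists>y\<in>carrier E. y \<otimes>\<^bsub>E\<^esub> x = \<one>\<^bsub>E\<^esub>" by blast
qed (auto simp: carrier_ext mult_ext one_ext pow_closed k_pos pow_one m_assoc pow_mult
        pow_mod funpow_add mod_add_right_eq mod_add_left_eq add.assoc)

lemma base_hom: "(\<lambda>v. (v, 0)) \<in> hom V E"
  by (rule homI) (simp_all add: carrier_ext mult_ext k_pos)

lemma conj_by_base:
  assumes "w \<in> carrier V" "c < k"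
  shows "(w, 0) \<otimes>\<^bsub>E\<^esub> (\<one>, c) \<otimes>\<^bsub>E\<^esub> inv\<^bsub>E\<^esub> (w, 0) = (w \<otimes> (\<sigma> ^^ c) (inv w), c)"
proof -
  have "inv\<^bsub>E\<^esub> (w, 0) = (inv w, 0)"
    using group_hom.hom_inv[of V E "\<lambda>v. (v, 0)" w] assms(1) base_hom group_ext is_group
    by (simp add: group_hom_def group_hom_axioms_def)
  then show ?thesis using assms by (simp add: mult_ext)
qed

lemma base_int_pow: "v \<in> carrier V \<Longrightarrow> (v, 0) [^]\<^bsub>E\<^esub> (n :: int) = (v [^] n, 0)"
  using hom_int_pow[OF base_hom, of v n] group_ext is_group by simp

end

lemma int_pow_eq_one_if_dvd:
  assumes "group G" "x \<in> carrier G" "x [^]\<^bsub>G\<^esub> (p :: nat) = \<one>\<^bsub>G\<^esub>" "int p dvd k"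
  shows "x [^]\<^bsub>G\<^esub> (k :: int) = \<one>\<^bsub>G\<^esub>"
proof -
  interpret group G by fact
  obtain j where "k = int p * j" using assms(4) by blast
  then have "x [^]\<^bsub>G\<^esub> k = (x [^]\<^bsub>G\<^esub> int p) [^]\<^bsub>G\<^esub> j" using assms(2) by (simp add: int_pow_pow)
  then show ?thesis using assms(3) by (simp add: int_pow_int)
qed

lemma int_pow_DirProd:
  assumes "group G" "group H" "x \<in> carrier G" "y \<in> carrier H"
  shows "(x, y) [^]\<^bsub>G \<times>\<times> H\<^esub> (k :: int) = (x [^]\<^bsub>G\<^esub> k, y [^]\<^bsub>H\<^esub> k)"
proof -
  interpret G: group G by fact
  interpret H: group H by fact
  interpret GH: group "G \<times>\<times> H" by (rule DirProd_group[OF assms(1,2)])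
  have nat_case: "(x, y) [^]\<^bsub>G \<times>\<times> H\<^esub> (n :: nat) = (x [^]\<^bsub>G\<^esub> n, y [^]\<^bsub>H\<^esub> n)" for n
    by (induction n) auto
  show ?thesis
    unfolding int_pow_def2 Let_def nat_case by (simp add: inv_DirProd[OF assms(1,2)] assms)
qed

text \<open>
  Let \<open>V\<close> be a plane over the field with \<open>p\<close> elements and let a cyclic group of order \<open>p - 1\<close> act on it by powers
  of the scalar \<open>l = Y / X\<close>. Choosing \<open>a, b\<close> in \<open>V\<close> and \<open>t\<close> in the coset that acts by \<open>l\<close> always gives
  a lollipop triple, since \<open>p\<close> kills \<open>V\<close> and \<open>l X = Y\<close>. These are \<open>p\<^sup>6\<close> triples in a group of
  order \<open>p\<^sup>2 (p - 1)\<close>, more than the square of the order.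
\<close>

lemma not_two_generated_if_no_divisor:
  fixes p :: nat and Q R X Y :: int
  assumes p: "prime p" and dvd: "int p dvd Q" "int p dvd R"
    and ndvd: "\<not> int p dvd X" "\<not> int p dvd Y"
  shows "\<not> two_generated (lollipop_group Q R X Y)"
proof
  assume two: "two_generated (lollipop_group Q R X Y)"
  let ?Z = "integer_mod_group p"
  let ?V = "?Z \<times>\<times> ?Z"
  have p0: "p > 0" using p by (simp add: prime_gt_0_nat)
  have carrZ: "carrier ?Z = {0..<int p}" using p0 by (simp add: carrier_integer_mod_group)
  have cop: "coprime X (int p)"
    using prime_imp_coprime[of "int p" X] ndvd(1) p by (simp add: coprime_commute)
  obtain Xi where Xi: "[X * Xi = 1] (mod int p)"
    using cong_solve_coprime_int[OF cop] by blast
  define l where "l = nat (Xi * Y mod int p)"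
  have l: "[int l = Xi * Y] (mod int p)"
    using p0 by (simp add: l_def cong_def)
  have lX: "[int l * X = Y] (mod int p)"
    using cong_scalar_right[OF l, of X] cong_scalar_right[OF Xi, of Y]
    by (simp add: cong_def mult_ac)
  have ndvd_l: "\<not> p dvd l"
    using lX ndvd(2) by (metis cong_dvd_iff dvd_mult2 int_dvd_int_iff)
  define k where "k = p - 1"
  have k: "0 < k" "k < p" using prime_gt_1_nat[OF p] by (auto simp: k_def)
  have "[int (l ^ k) = int 1] (mod int p)"
    unfolding k_def using fermat_theorem[OF p] ndvd_l by (simp only: cong_int_iff)
  then have lpow: "[int l ^ k = 1] (mod int p)"
    by simp
  define \<sigma> where "\<sigma> = (\<lambda>(x, y). (int l * x mod int p, int l * y mod int p))"
  have \<sigma>_pow: "(\<sigma> ^^ c) (x, y) = (int l ^ c * x mod int p, int l ^ c * y mod int p)"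
    if "(x, y) \<in> carrier ?V" for c x y
    using that by (induction c) (auto simp: \<sigma>_def carrZ mod_mult_right_eq mult.assoc)
  interpret V: cyclic_action ?V \<sigma> "k"
  proof (intro cyclic_action.intro cyclic_action_axioms.intro)
    show "group ?V" by (rule DirProd_group) simp_all
    show "\<sigma> \<in> hom ?V ?V"
      using p0 by (auto intro!: homI simp: \<sigma>_def carrZ mod_simps distrib_left)
    show "0 < k" by (rule k(1))
    show "(\<sigma> ^^ k) v = v" if "v \<in> carrier ?V" for v
    proof -
      obtain x y where v: "v = (x, y)" by (cases v)
      have "int l ^ k * z mod int p = z" if "z \<in> {0..<int p}" for z
        using cong_scalar_right[OF lpow, of z] that by (simp add: cong_def)
      then show ?thesis using that unfolding v by (simp add: \<sigma>_pow carrZ)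
    qed
  qed
  let ?T = "{(a, b, t). lollipop_triple V.E Q R X Y a b t}"
  \<comment> \<open>The reduction matters for \<open>p = 2\<close>, where \<open>k = 1\<close> and the acting group is trivial.\<close>
  define c where "c = 1 mod k"
  have c: "c < k" unfolding c_def by (rule mod_less_divisor[OF V.k_pos])
  have \<sigma>_c: "(\<sigma> ^^ c) v = \<sigma> v" if "v \<in> carrier ?V" for v
    using V.pow_mod[OF that, of 1] by (simp only: c_def One_nat_def funpow.simps o_apply id_apply)
  have pow_dvd: "v [^]\<^bsub>?V\<^esub> n = \<one>\<^bsub>?V\<^esub>" if "v \<in> carrier ?V" "int p dvd n" for v and n :: int
    using that by (cases v) (auto simp: int_pow_DirProd int_pow_integer_mod_group)
  have triple: "lollipop_triple V.E Q R X Y (a, 0) (b, 0) (t, c)"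
    if "a \<in> carrier ?V" "b \<in> carrier ?V" "t \<in> carrier ?V" for a b t
  proof -
    interpret E: group V.E by (rule V.group_ext)
    obtain b1 b2 where b: "b = (b1, b2)" by (cases b)
    obtain t1 t2 where t: "t = (t1, t2)" by (cases t)
    have "(\<sigma> ^^ c) (b [^]\<^bsub>?V\<^esub> X) = \<sigma> (b [^]\<^bsub>?V\<^esub> X)"
      using that(2) by (intro \<sigma>_c V.int_pow_closed)
    also have "\<dots> = b [^]\<^bsub>?V\<^esub> Y"
    proof -
      have "int l * (X * z) mod int p = Y * z mod int p" for z
        using cong_scalar_right[OF lX, of z] by (simp add: cong_def mult.assoc)
      then show ?thesis
        using that(2) unfolding b
        by (simp add: int_pow_DirProd int_pow_integer_mod_group \<sigma>_def mod_mult_right_eq)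
    qed
    finally have s: "(\<sigma> ^^ c) (b [^]\<^bsub>?V\<^esub> X) = b [^]\<^bsub>?V\<^esub> Y" .
    have comm: "t \<otimes>\<^bsub>?V\<^esub> b [^]\<^bsub>?V\<^esub> Y = b [^]\<^bsub>?V\<^esub> Y \<otimes>\<^bsub>?V\<^esub> t"
      using that(2) unfolding b t
      by (simp add: int_pow_DirProd int_pow_integer_mod_group add.commute)
    have "(t, c) \<otimes>\<^bsub>V.E\<^esub> (b, 0) [^]\<^bsub>V.E\<^esub> X = (b, 0) [^]\<^bsub>V.E\<^esub> Y \<otimes>\<^bsub>V.E\<^esub> (t, c)"
      using that by (simp only: V.base_int_pow V.mult_ext s comm funpow_0) simp
    moreover have "(a, 0) \<in> carrier V.E" "(b, 0) \<in> carrier V.E" "(t, c) \<in> carrier V.E"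
      using that c by (simp_all add: V.carrier_ext)
    moreover have "(a, 0) [^]\<^bsub>V.E\<^esub> Q = (b, 0) [^]\<^bsub>V.E\<^esub> R"
      using that dvd by (simp only: V.base_int_pow pow_dvd)
    ultimately show ?thesis by (intro E.lollipop_tripleI)
  qed
  let ?F = "\<lambda>(a, b, t). ((a, 0), (b, 0), (t, c))"
  have card_V: "card (carrier ?V) = p ^ 2"
    by (simp add: carrZ card_cartesian_product power2_eq_square)
  have fin: "finite (carrier V.E)" by (simp add: V.carrier_ext carrZ)
  have "card (carrier ?V \<times> carrier ?V \<times> carrier ?V) \<le> card ?T"
  proof (rule card_inj_on_le[of ?F])
    show "inj_on ?F (carrier ?V \<times> carrier ?V \<times> carrier ?V)" by (auto simp: inj_on_def)
    show "?F ` (carrier ?V \<times> carrier ?V \<times> carrier ?V) \<subseteq> ?T" using triple by auto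
    show "finite ?T"
      by (rule finite_subset[of _ "carrier V.E \<times> carrier V.E \<times> carrier V.E"])
         (auto simp: lollipop_triple_def fin)
  qed
  also have "\<dots> \<le> card (carrier V.E) ^ 2"
    by (rule two_generated_card_triples[OF two V.group_ext fin])
  finally have "p ^ 2 * (p ^ 2 * p ^ 2) \<le> (p ^ 2 * k) ^ 2"
    by (simp only: card_cartesian_product card_V V.carrier_ext card_atLeastLessThan diff_zero)
  also have "\<dots> < (p ^ 2 * p) ^ 2"
    using p0 k by (intro power_strict_mono) auto
  also have "\<dots> = p ^ 2 * (p ^ 2 * p ^ 2)" by (simp add: eval_nat_numeral)
  finally show False by simp
qed

lemma int_pow_product_group:
  assumes "\<And>i. i \<in> I \<Longrightarrow> group (G i)" "v \<in> carrier (product_group I G)" "i \<in> I"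
  shows "(v [^]\<^bsub>product_group I G\<^esub> (k :: int)) i = v i [^]\<^bsub>G i\<^esub> k"
proof -
  have "(\<lambda>v. v i) \<in> hom (product_group I G) (G i)"
    using assms(3) by (auto intro!: homI)
  then show ?thesis
    using hom_int_pow[of "\<lambda>v. v i" "product_group I G" "G i" v k] assms by simp
qed

text \<open>
  Here the lollipop group maps onto the free product of cyclic groups of orders \<open>p\<close>, \<open>q\<close> and infinity.
  It suffices to find a finite group \<open>S\<close> in which the number of solutions of \<open>a\<^sup>p = 1\<close> times the number
  of solutions of \<open>b\<^sup>q = 1\<close> exceeds \<open>|S|\<close>, because \<open>t\<close> is then arbitrary. The wreath product of the cyclic
  groups of orders \<open>q\<close> and \<open>p\<close> works. Its base has \<open>q\<^sup>p\<close> elements, all with \<open>b\<^sup>q = 1\<close>, and there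
  are at least \<open>q\<^bsup>p-1\<^esup> + 1 > p\<close> solutions of \<open>a\<^sup>p = 1\<close>: the identity and the conjugates of the
  shift by the base.
\<close>

lemma not_two_generated_if_common_factor:
  fixes p q :: nat and Q R X Y :: int
  assumes p: "prime p" "int p dvd Q" and q: "prime q" "int q dvd R" "int q dvd X" "int q dvd Y"
  shows "\<not> two_generated (lollipop_group Q R X Y)"
proof
  assume two: "two_generated (lollipop_group Q R X Y)"
  let ?Z = "integer_mod_group q"
  let ?V = "product_group {0..<p} (\<lambda>_. ?Z)"
  have q0: "q > 0" and p1: "p > 1" and q1: "q > 1"
    using p q by (simp_all add: prime_gt_0_nat prime_gt_1_nat del: One_nat_def)
  have carrZ: "carrier ?Z = {0..<int q}" using q0 by (simp add: carrier_integer_mod_group)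
  have carrV: "carrier ?V = {0..<p} \<rightarrow>\<^sub>E {0..<int q}" by (simp add: carrZ)
  define \<sigma> where "\<sigma> v = (\<lambda>i\<in>{0..<p}. v (Suc i mod p))" for v :: "nat \<Rightarrow> int"
  have \<sigma>_pow: "(\<sigma> ^^ c) v = (\<lambda>i\<in>{0..<p}. v ((i + c) mod p))" if "v \<in> carrier ?V" for c v
  proof (induction c)
    case 0
    then show ?case using that by (auto simp: carrV fun_eq_iff PiE_iff extensional_def)
  next
    case (Suc c)
    then show ?case using p1 by (auto simp: \<sigma>_def fun_eq_iff mod_add_left_eq mod_Suc_eq)
  qed
  have "group ?V" by (rule product_group) simp_all
  interpret V: cyclic_action ?V \<sigma> p
  proof (intro cyclic_action.intro cyclic_action_axioms.intro)
    show "group ?V" by fact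
    show "\<sigma> \<in> hom ?V ?V"
      using p1 by (intro homI) (auto simp: \<sigma>_def carrZ PiE_iff fun_eq_iff)
    show "0 < p" using p1 by simp
    show "(\<sigma> ^^ p) v = v" if "v \<in> carrier ?V" for v
      unfolding \<sigma>_pow[OF that] using that by (auto simp: carrV fun_eq_iff PiE_iff extensional_def)
  qed
  interpret E: group V.E by (rule V.group_ext)
  have fin: "finite (carrier V.E)"
    unfolding V.carrier_ext carrV by (auto intro!: finite_PiE)
  have V_pow: "v [^]\<^bsub>?V\<^esub> k = \<one>\<^bsub>?V\<^esub>" if "v \<in> carrier ?V" "int q dvd k" for v and k :: int
  proof
    fix i
    have "v [^]\<^bsub>?V\<^esub> k \<in> carrier ?V" by (rule V.int_pow_closed[OF that(1)])
    moreover have "i \<in> {0..<p} \<Longrightarrow> (v [^]\<^bsub>?V\<^esub> k) i = 0"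
      using int_pow_product_group[of "{0..<p}" "\<lambda>_. ?Z" v i k] that
      by (simp add: int_pow_integer_mod_group)
    ultimately show "(v [^]\<^bsub>?V\<^esub> k) i = \<one>\<^bsub>?V\<^esub> i"
      by (auto simp: carrV PiE_iff extensional_def)
  qed
  define g where "g = (\<one>\<^bsub>?V\<^esub>, 1 :: nat)"
  have g: "g \<in> carrier V.E" using p1 by (simp add: g_def V.carrier_ext)
  have "1 mod p = 1" using p1 by (simp del: One_nat_def)
  then have g_pow: "g [^]\<^bsub>V.E\<^esub> p = \<one>\<^bsub>V.E\<^esub>"
    using V.shift_nat_pow[of p] unfolding g_def V.one_ext by (simp only: mod_self)
  \<comment> \<open>The conjugate of the shift by \<open>w\<close> depends on \<open>w\<close> modulo constants only; \<open>w 0 = 0\<close> picks representatives.\<close>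
  define W where "W = {w \<in> carrier ?V. w 0 = 0}"
  define cj where "cj w = (w, 0) \<otimes>\<^bsub>V.E\<^esub> g \<otimes>\<^bsub>V.E\<^esub> inv\<^bsub>V.E\<^esub> (w, 0)" for w
  have W_E: "(w, 0) \<in> carrier V.E" if "w \<in> W" for w
    using that p1 by (simp add: W_def V.carrier_ext)
  have cj_closed: "cj w \<in> carrier V.E" if "w \<in> W" for w
    using W_E[OF that] g by (simp add: cj_def)
  have cj_pow: "cj w [^]\<^bsub>V.E\<^esub> Q = \<one>\<^bsub>V.E\<^esub>" if "w \<in> W" for w
  proof -
    have "g [^]\<^bsub>V.E\<^esub> Q = \<one>\<^bsub>V.E\<^esub>"
      by (rule int_pow_eq_one_if_dvd[OF V.group_ext g g_pow p(2)])
    then show ?thesis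
      unfolding cj_def E.conj_int_pow[OF W_E[OF that] g] using W_E[OF that] by simp
  qed
  have cj_eq: "cj w = (\<lambda>i\<in>{0..<p}. (w i - w (Suc i mod p)) mod int q, 1)" if "w \<in> W" for w
  proof -
    have w: "w \<in> carrier ?V" using that by (simp add: W_def)
    have "cj w = (w \<otimes>\<^bsub>?V\<^esub> \<sigma> (inv\<^bsub>?V\<^esub> w), 1)"
      using V.conj_by_base[OF w p1] unfolding cj_def g_def
      by (simp only: One_nat_def funpow.simps o_apply id_apply)
    moreover have "w \<otimes>\<^bsub>?V\<^esub> \<sigma> (inv\<^bsub>?V\<^esub> w) = (\<lambda>i\<in>{0..<p}. (w i - w (Suc i mod p)) mod int q)"
      using w p1 by (auto simp: \<sigma>_def fun_eq_iff PiE_iff mod_simps)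
    ultimately show ?thesis by simp
  qed
  have inj: "inj_on cj W"
  proof (rule inj_onI)
    fix v w assume v: "v \<in> W" and w: "w \<in> W" and eq: "cj v = cj w"
    have range: "u i \<in> {0..<int q}" if "u \<in> W" "i < p" for u i
      using that by (auto simp: W_def carrZ PiE_iff extensional_def)
    have step: "(v i - v (Suc i)) mod int q = (w i - w (Suc i)) mod int q" if "Suc i < p" for i
      using eq that unfolding cj_eq[OF v] cj_eq[OF w] by (auto simp: fun_eq_iff dest!: spec[of _ i])
    have "i < p \<longrightarrow> v i = w i" for i
    proof (induction i)
      case 0
      then show ?case using v w by (simp add: W_def)
    next
      case (Suc i)
      show ?case
      proof
        assume i: "Suc i < p"
        have "[v i - v (Suc i) = w i - w (Suc i)] (mod int q)"
          using step[OF i] by (simp add: cong_def)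
        then have "[v (Suc i) = w (Suc i)] (mod int q)"
          using Suc i cong_diff_iff_cong_0 by (auto simp: cong_iff_dvd_diff dvd_diff_commute)
        then show "v (Suc i) = w (Suc i)"
          using range[OF v i] range[OF w i] by (simp add: cong_def)
      qed
    qed
    moreover have "v \<in> extensional {0..<p}" "w \<in> extensional {0..<p}"
      using v w by (auto simp: W_def PiE_iff)
    ultimately show "v = w" by (intro extensionalityI[of v "{0..<p}" w]) auto
  qed
  have cj_one: "cj w \<noteq> \<one>\<^bsub>V.E\<^esub>" if "w \<in> W" for w
    by (simp add: cj_eq[OF that] V.one_ext)
  have card_W: "card W = q ^ (p - 1)"
  proof -
    obtain n where n: "p = Suc n" using p1 by (cases p) auto
    have "W = (\<Pi>\<^sub>E i\<in>{0..<p}. if i = 0 then {0} else {0..<int q})"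
      (is "_ = ?P")
    proof
      show "W \<subseteq> ?P" by (auto simp: W_def carrZ PiE_iff extensional_def)
      have "?P \<subseteq> carrier ?V"
        unfolding carrV using q0 by (intro PiE_mono) auto
      moreover have "w 0 = 0" if "w \<in> ?P" for w
        using PiE_mem[OF that, of 0] p1 by simp
      ultimately show "?P \<subseteq> W" unfolding W_def by blast
    qed
    then have "card W = (\<Prod>i\<in>{0..<p}. card (if i = 0 then {0} else {0..<int q}))"
      by (simp add: card_PiE)
    also have "\<dots> = q ^ (p - 1)"
      unfolding n by (subst prod.atLeast0_lessThan_Suc_shift) simp
    finally show ?thesis .
  qed
  let ?A = "insert \<one>\<^bsub>V.E\<^esub> (cj ` W)" and ?B = "(\<lambda>v. (v, 0 :: nat)) ` carrier ?V"
  let ?T = "{(a, b, t). lollipop_triple V.E Q R X Y a b t}"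
  have sub: "?A \<times> ?B \<times> carrier V.E \<subseteq> ?T"
  proof clarify
    fix a b t v
    assume a: "a \<in> ?A" and v: "v \<in> carrier ?V" and t: "t \<in> carrier V.E"
    have b: "(v, 0) \<in> carrier V.E" using v p1 by (simp only: V.carrier_ext) simp
    have b_pow: "(v, 0) [^]\<^bsub>V.E\<^esub> k = \<one>\<^bsub>V.E\<^esub>" if "int q dvd k" for k :: int
      unfolding V.base_int_pow[OF v] V_pow[OF v that] V.one_ext ..
    have "a \<in> carrier V.E" "a [^]\<^bsub>V.E\<^esub> Q = \<one>\<^bsub>V.E\<^esub>"
      using a cj_closed cj_pow by auto
    then show "lollipop_triple V.E Q R X Y a (v, 0) t"
      using t b by (intro E.lollipop_tripleI) (simp_all add: b_pow q)
  qed
  have card_V: "card (carrier ?V) = q ^ p"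
    unfolding carrV by (simp add: card_PiE)
  have finW: "finite W" using card_W q0 by (metis card.infinite power_eq_0_iff less_irrefl)
  have "\<one>\<^bsub>V.E\<^esub> \<notin> cj ` W"
    using cj_one by (metis imageE)
  then have "card ?A = q ^ (p - 1) + 1"
    using finW by (simp add: card_image[OF inj] card_W)
  moreover have "card ?B = q ^ p"
    unfolding card_V[symmetric] by (rule card_image) (simp add: inj_on_def)
  moreover have "card (carrier V.E) = q ^ p * p"
    by (simp only: V.carrier_ext card_cartesian_product card_V card_atLeastLessThan diff_zero)
  moreover have "card (?A \<times> ?B \<times> carrier V.E) \<le> card (carrier V.E) ^ 2"
  proof -
    have "finite ?T"
      by (rule finite_subset[of _ "carrier V.E \<times> carrier V.E \<times> carrier V.E"])
         (auto simp: lollipop_triple_def fin)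
    then have "card (?A \<times> ?B \<times> carrier V.E) \<le> card ?T"
      using sub by (rule card_mono)
    also have "\<dots> \<le> card (carrier V.E) ^ 2"
      by (rule two_generated_card_triples[OF two V.group_ext fin])
    finally show ?thesis .
  qed
  ultimately have le: "(q ^ (p - 1) + 1) * (q ^ p * (q ^ p * p)) \<le> (q ^ p * p) ^ 2"
    by (simp only: card_cartesian_product)
  have "p \<le> 2 ^ (p - 1)"
    using less_exp[of "p - 1"] p1 by linarith
  also have "\<dots> \<le> q ^ (p - 1)"
    using q1 by (intro power_mono) auto
  finally have "p < q ^ (p - 1) + 1" by simp
  then have "p * (q ^ p * (q ^ p * p)) < (q ^ (p - 1) + 1) * (q ^ p * (q ^ p * p))"
    using q0 p1 by (intro mult_strict_right_mono) auto
  with le show False by (simp add: power2_eq_square mult_ac)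
qed

section \<open>Generating triples in Baumslag-Solitar groups\<close>

lemma (in group) subgroup_int_pow:
  assumes "subgroup H G" "x \<in> H"
  shows "x [^] (k :: int) \<in> H"
proof -
  interpret H: group "G\<lparr>carrier := H\<rparr>" by (rule subgroup.subgroup_is_group[OF assms(1) is_group])
  show ?thesis
    using H.int_pow_closed[of x k] int_pow_consistent[OF assms] assms(2) by simp
qed

lemma (in group) mem_subgroup_if_coprime_powers:
  assumes "subgroup H G" "x \<in> carrier G" "x [^] (i :: int) \<in> H" "x [^] (j :: int) \<in> H"
    and "coprime i j"
  shows "x \<in> H"
proof -
  obtain u v where uv: "u * i + v * j = 1"
    using assms(5) bezout_int[of i j] by auto
  have "x [^] (i * u) \<otimes> x [^] (j * v) \<in> H"
    using subgroup_int_pow[OF assms(1,3), of u] subgroup_int_pow[OF assms(1,4), of v]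
      subgroup.m_closed[OF assms(1)] assms(2) by (simp add: int_pow_pow)
  also have "x [^] (i * u) \<otimes> x [^] (j * v) = x [^] (i * u + j * v)"
    using assms(2) by (simp add: int_pow_mult)
  also have "i * u + j * v = 1" using uv by (simp add: mult.commute)
  finally show ?thesis using assms(2) by simp
qed

locale bs_relation = group G for G (structure) +
  fixes \<alpha> \<tau> and m n :: int
  assumes \<alpha>: "\<alpha> \<in> carrier G" and \<tau>: "\<tau> \<in> carrier G"
    and gen: "generate G {\<alpha>, \<tau>} = carrier G"
    and bs_rel: "\<tau> \<otimes> \<alpha> [^] m = \<alpha> [^] n \<otimes> \<tau>"
begin

lemma bs_rel_mult: "\<tau> \<otimes> \<alpha> [^] (m * s) = \<alpha> [^] (n * s) \<otimes> \<tau>"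
proof -
  have "\<tau> \<otimes> \<alpha> [^] m \<otimes> inv \<tau> = \<alpha> [^] n"
    using conj_eq_iff[of \<tau> "\<alpha> [^] m" "\<alpha> [^] n"] bs_rel \<alpha> \<tau> by blast
  then have "\<tau> \<otimes> (\<alpha> [^] m) [^] s \<otimes> inv \<tau> = (\<alpha> [^] n) [^] s"
    using conj_int_pow[of \<tau> "\<alpha> [^] m" s] \<alpha> \<tau> by simp
  then show ?thesis
    using conj_eq_iff \<alpha> \<tau> by (simp add: int_pow_pow)
qed

lemma generate_eq_carrier_if_coprime:
  assumes abt: "a \<in> carrier G" "b \<in> carrier G" "t \<in> carrier G"
    and mem: "\<tau> \<in> generate G {a, b, t}" "\<alpha> [^] (i :: int) \<in> generate G {a, b, t}"
      "\<alpha> [^] (j :: int) \<in> generate G {a, b, t}"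
    and "coprime i j"
  shows "generate G {a, b, t} = carrier G"
proof
  have sub: "subgroup (generate G {a, b, t}) G"
    by (rule generate_is_subgroup) (use abt in auto)
  have "\<alpha> \<in> generate G {a, b, t}"
    using mem_subgroup_if_coprime_powers[OF sub \<alpha> mem(2,3) assms(7)] .
  then have "generate G {\<alpha>, \<tau>} \<subseteq> generate G {a, b, t}"
    using mem(1) by (intro generate_subgroup_incl[OF _ sub]) auto
  then show "carrier G \<subseteq> generate G {a, b, t}" by (simp add: gen)
  show "generate G {a, b, t} \<subseteq> carrier G"
    by (rule generate_incl) (use abt in auto)
qed

text \<open>
  Each conjugation by \<open>\<tau>\<close> trades one factor \<open>x\<close> of the exponent for a factor \<open>y\<close>; the exponent
  stays a multiple of \<open>m\<close> until the factors \<open>x\<close> are used up.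
\<close>

lemma bs_rel_iterate:
  "\<tau> [^] (k :: nat) \<otimes> \<alpha> [^] (d * (x ^ k * s)) = \<alpha> [^] (d * (y ^ k * s)) \<otimes> \<tau> [^] k"
  if mn: "m = d * x" "n = d * y" for d x y s :: int
proof (induction k arbitrary: s)
  case 0
  then show ?case using \<alpha> by simp
next
  case (Suc k)
  have "\<tau> [^] Suc k \<otimes> \<alpha> [^] (d * (x ^ Suc k * s)) = \<tau> [^] k \<otimes> (\<tau> \<otimes> \<alpha> [^] (m * (x ^ k * s)))"
    using \<alpha> \<tau> by (simp add: m_assoc mn mult_ac)
  also have "\<dots> = \<tau> [^] k \<otimes> (\<alpha> [^] (n * (x ^ k * s)) \<otimes> \<tau>)"
    by (simp only: bs_rel_mult)
  also have "\<dots> = \<tau> [^] k \<otimes> \<alpha> [^] (d * (x ^ k * (y * s))) \<otimes> \<tau>"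
    using \<alpha> \<tau> by (simp add: m_assoc mn mult_ac)
  also have "\<dots> = \<alpha> [^] (d * (y ^ k * (y * s))) \<otimes> \<tau> [^] k \<otimes> \<tau>"
    by (simp only: Suc)
  finally show ?case using \<alpha> \<tau> by (simp add: m_assoc mult_ac)
qed

end

text \<open>
  Divide out \<open>gcd r y\<close> repeatedly.
\<close>

lemma coprime_part_decomposition:
  fixes r y :: int
  assumes "r \<noteq> 0"
  shows "\<exists>r1 r2 k. r = r1 * r2 \<and> r2 dvd y ^ k \<and> coprime r1 y"
  using assms
proof (induction "nat \<bar>r\<bar>" arbitrary: r rule: less_induct)
  case less
  show ?case
  proof (cases "coprime r y")
    case True
    then show ?thesis by (intro exI[of _ r] exI[of _ 1]) simp
  next
    case False
    define g where "g = gcd r y"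
    obtain r' where r': "r = g * r'" unfolding g_def by (meson dvd_def gcd_dvd1)
    have "g > 1"
      using False less.prems unfolding g_def coprime_iff_gcd_eq_1
      by (metis gcd_eq_0_iff gcd_ge_0_int linorder_neqE_linordered_idom not_less zle_diff1_eq zle_add1_eq_le zless_imp_add1_zle add_0)
    moreover have "r' \<noteq> 0" using less.prems r' by auto
    ultimately have "nat \<bar>r'\<bar> < nat \<bar>r\<bar>" by (simp add: r' abs_mult)
    then obtain r1 r2 k where IH: "r' = r1 * r2" "r2 dvd y ^ k" "coprime r1 y"
      using less.hyps[of r'] \<open>r' \<noteq> 0\<close> by blast
    have "g * r2 dvd y ^ Suc k" unfolding g_def using IH(2) by (simp add: mult_dvd_mono)
    moreover have "r = r1 * (g * r2)" by (simp add: r' IH(1))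
    ultimately show ?thesis using IH(3) by blast
  qed
qed

lemma (in bs_relation) lollipop_triple_if_coprime_QR:
  assumes "m = Q * X" "n = Q * Y" "coprime Q R"
  shows "\<exists>a b t. lollipop_triple G Q R X Y a b t \<and> generate G {a, b, t} = carrier G"
proof (intro exI conjI)
  show "lollipop_triple G Q R X Y (\<alpha> [^] R) (\<alpha> [^] Q) \<tau>"
    using bs_rel \<alpha> \<tau> assms(1,2) by (intro lollipop_tripleI) (simp_all add: int_pow_pow mult.commute)
  show "generate G {\<alpha> [^] R, \<alpha> [^] Q, \<tau>} = carrier G"
    using \<alpha> \<tau> assms(3)
    by (intro generate_eq_carrier_if_coprime[of _ _ _ Q R]) (auto intro: generate.incl)
qed

text \<open>
  The triple \<open>\<alpha>\<^sup>R, \<alpha>\<^sup>Q, \<tau>\<close> does not generate when \<open>Q\<close> and \<open>R\<close> have a common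
  prime. Such a prime divides \<open>Y\<close>, so it can be moved: multiplying the exponent of \<open>b\<close> by \<open>Y\<^sup>k / r2\<close>
  makes \<open>b\<^sup>R\<close> conjugate under \<open>\<tau>\<^sup>k\<close> to a power of \<open>\<alpha>\<close> whose exponent contains \<open>X\<^sup>k\<close> in place of \<open>r2\<close>,
  and \<open>X\<close> is coprime to \<open>Q\<close>.
\<close>

lemma (in bs_relation) lollipop_triple_if_coprime_X:
  assumes mn: "m = Q * X" "n = Q * Y" and cop: "coprime X (Q * Y)" and "R \<noteq> 0"
    and primes: "\<And>p. prime p \<Longrightarrow> p dvd Q \<Longrightarrow> p dvd R \<Longrightarrow> p dvd Y"
  shows "\<exists>a b t. lollipop_triple G Q R X Y a b t \<and> generate G {a, b, t} = carrier G"
proof -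
  obtain r1 r2 k where R: "R = r1 * r2" "r2 dvd Y ^ k" "coprime r1 Y"
    using coprime_part_decomposition[OF assms(4), of Y] by blast
  obtain s where s: "Y ^ k = r2 * s" using R(2) by blast
  have "coprime r1 Q"
  proof (rule ccontr)
    assume "\<not> coprime r1 Q"
    then obtain p where p: "prime p" "p dvd r1" "p dvd Q"
      using prime_divisor_exists[of "gcd r1 Q"] assms(4) R(1) by (auto simp: is_unit_gcd)
    then have "p dvd Y" using primes R(1) by simp
    then show False using R(3) p coprime_common_divisor not_prime_unit by blast
  qed
  moreover have "coprime r1 s" "coprime X s"
  proof -
    have "s dvd Y ^ k" using s by simp
    moreover have "coprime r1 (Y ^ k)" "coprime X (Y ^ k)"
      using R(3) cop by simp_all
    ultimately show "coprime r1 s" "coprime X s"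
      by (meson coprime_divisors dvd_refl)+
  qed
  ultimately have cop': "coprime (X ^ k * r1) (Q * s)"
    using cop by simp
  let ?a = "\<tau> [^] k \<otimes> \<alpha> [^] (X ^ k * r1) \<otimes> inv (\<tau> [^] k)" and ?b = "\<alpha> [^] (Q * s)"
  have a: "?a \<in> carrier G" and b: "?b \<in> carrier G" using \<alpha> \<tau> by simp_all
  have "?a [^] Q = \<tau> [^] k \<otimes> \<alpha> [^] (Q * (X ^ k * r1)) \<otimes> inv (\<tau> [^] k)"
    using \<alpha> \<tau> by (simp add: conj_int_pow int_pow_pow mult_ac)
  also have "\<dots> = \<alpha> [^] (Q * (Y ^ k * r1))"
    by (rule iffD2[OF conj_eq_iff bs_rel_iterate[OF mn]]) (simp_all add: \<alpha> \<tau>)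
  also have "\<dots> = ?b [^] R"
    using \<alpha> by (simp add: int_pow_pow R(1) s mult_ac)
  finally have "?a [^] Q = ?b [^] R" .
  moreover have "\<tau> \<otimes> ?b [^] X = ?b [^] Y \<otimes> \<tau>"
    using \<alpha> bs_rel_mult[of s] by (simp add: int_pow_pow mn mult_ac)
  ultimately have "lollipop_triple G Q R X Y ?a ?b \<tau>"
    using a b \<tau> by (intro lollipop_tripleI)
  moreover have "generate G {?a, ?b, \<tau>} = carrier G"
  proof (rule generate_eq_carrier_if_coprime[OF a b \<tau> _ _ _ cop'])
    let ?H = "generate G {?a, ?b, \<tau>}"
    have sub: "subgroup ?H G"
      by (rule generate_is_subgroup) (use a b \<tau> in auto)
    show \<tau>H: "\<tau> \<in> ?H" and "?b \<in> ?H" by (auto intro: generate.incl)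
    have \<tau>k: "\<tau> [^] k \<in> ?H"
      using subgroup_int_pow[OF sub \<tau>H, of "int k"] by (simp add: int_pow_int)
    have "?a \<in> ?H" by (auto intro: generate.incl)
    then have "inv (\<tau> [^] k) \<otimes> (?a \<otimes> \<tau> [^] k) \<in> ?H"
      using \<tau>k subgroup.m_closed[OF sub] subgroup.m_inv_closed[OF sub] by blast
    moreover have "?a \<otimes> \<tau> [^] k = \<tau> [^] k \<otimes> \<alpha> [^] (X ^ k * r1)"
      using \<alpha> \<tau> by (simp add: m_assoc)
    moreover have "inv (\<tau> [^] k) \<otimes> (\<tau> [^] k \<otimes> \<alpha> [^] (X ^ k * r1)) = \<alpha> [^] (X ^ k * r1)"
      using \<alpha> \<tau> by (simp flip: m_assoc)
    ultimately show "\<alpha> [^] (X ^ k * r1) \<in> ?H" by simp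
  qed
  ultimately show ?thesis by blast
qed

section \<open>Action of words on Britton normal forms\<close>

locale bs_forms =
  fixes m n :: int
  assumes m_nonzero: "m \<noteq> 0" and n_nonzero: "n \<noteq> 0"
begin

text \<open>
  A list of pairs \<open>(c, e)\<close> stands for the product of the syllables \<open>\<alpha>\<^sup>c \<tau>\<^bsup>\<plusminus>1\<^esup>\<close>, with sign \<open>+\<close>
  iff \<open>e\<close>; a normal form is such a list together with the exponent of a trailing power of \<open>\<alpha>\<close>.
  The relation reads \<open>\<alpha>\<^sup>n \<tau> = \<tau> \<alpha>\<^sup>m\<close> and \<open>\<alpha>\<^sup>m \<tau>\<^bsup>-1\<^esup> = \<tau>\<^bsup>-1\<^esup> \<alpha>\<^sup>n\<close>, so before
  \<open>\<tau>\<close> the exponent of \<open>\<alpha>\<close> matters modulo \<open>n\<close>, and before \<open>\<tau>\<^bsup>-1\<^esup>\<close> modulo \<open>m\<close>.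
\<close>

definition modulus :: "bool \<Rightarrow> int" where
  "modulus e = (if e then n else m)"

lemma modulus_nonzero: "modulus e \<noteq> 0"
  by (simp add: modulus_def m_nonzero n_nonzero)

text \<open>
  Multiplying a normal form by \<open>\<alpha>\<^sup>k\<close> on the left works like addition with carry in mixed radix:
  \<open>digits\<close> is the new list of syllables and \<open>carry\<close> is what reaches the trailing power of \<open>\<alpha>\<close>.
\<close>

primrec digits :: "(int \<times> bool) list \<Rightarrow> int \<Rightarrow> (int \<times> bool) list" where
  "digits [] k = []"
| "digits (x # l) k = ((fst x + k) mod modulus (snd x), snd x) #
     digits l (modulus (\<not> snd x) * ((fst x + k) div modulus (snd x)))"

primrec carry :: "(int \<times> bool) list \<Rightarrow> int \<Rightarrow> int" where
  "carry [] k = k"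
| "carry (x # l) k = carry l (modulus (\<not> snd x) * ((fst x + k) div modulus (snd x)))"

text \<open>
  A pinched pair is a subword \<open>\<tau>\<^bsup>\<plusminus>1\<^esup> \<alpha>\<^sup>c \<tau>\<^bsup>\<mp>1\<^esup>\<close> that equals a power of \<open>\<alpha>\<close>.
\<close>

definition pinched :: "int \<times> bool \<Rightarrow> int \<times> bool \<Rightarrow> bool" where
  "pinched x y \<longleftrightarrow> snd y = (\<not> snd x) \<and> modulus (snd y) dvd fst y"

definition reduced :: "(int \<times> bool) list \<Rightarrow> bool" where
  "reduced l \<longleftrightarrow> successively (\<lambda>x y. \<not> pinched x y) l"

definition normal :: "(int \<times> bool) list \<Rightarrow> bool" where
  "normal l \<longleftrightarrow> (\<forall>x\<in>set l. fst x mod modulus (snd x) = fst x) \<and> reduced l"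

text \<open>
  Left multiplication of a normal form by \<open>\<tau>\<close> or \<open>\<tau>\<^bsup>-1\<^esup>\<close>.
\<close>

definition turn :: "bool \<Rightarrow> (int \<times> bool) list \<Rightarrow> (int \<times> bool) list" where
  "turn e l = (if l \<noteq> [] \<and> pinched (0, e) (hd l) then tl l else (0, e) # l)"

lemma reduced_Nil: "reduced []"
  by (simp add: reduced_def)

lemma reduced_Cons: "reduced (x # l) \<longleftrightarrow> (l \<noteq> [] \<longrightarrow> \<not> pinched x (hd l)) \<and> reduced l"
  by (auto simp: reduced_def successively_Cons)

lemma pinched_cong: "snd x = snd x' \<Longrightarrow> pinched x y = pinched x' y"
  by (simp add: pinched_def)

lemma length_digits: "length (digits l k) = length l"
  by (induction l arbitrary: k) auto

text \<open>
  Carrying twice is carrying the sum: the reason why \<open>digits\<close> and \<open>carry\<close> define an action of the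
  integers.
\<close>

lemma carry_split: "modulus e * ((c + j + k) div modulus e') =
    modulus e * ((c + j) div modulus e') + modulus e * (((c + j) mod modulus e' + k) div modulus e')"
proof -
  have "c + j + k = ((c + j) mod modulus e' + k) + (c + j) div modulus e' * modulus e'"
    using div_mult_mod_eq[of "c + j" "modulus e'"] by linarith
  then have "(c + j + k) div modulus e' = (c + j) div modulus e' + ((c + j) mod modulus e' + k) div modulus e'"
    using modulus_nonzero[of e'] by (metis div_mult_self1 add.commute)
  then show ?thesis by (simp add: distrib_left)
qed

lemma digits_add: "digits l (j + k) = digits (digits l j) k"
  by (induction l arbitrary: j k) (simp_all add: mod_simps carry_split flip: add.assoc)

lemma carry_add: "carry l (j + k) = carry l j + carry (digits l j) k"
  by (induction l arbitrary: j k) (simp_all add: carry_split flip: add.assoc)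

lemma digits_0: "normal l \<Longrightarrow> digits l 0 = l"
  and carry_0: "normal l \<Longrightarrow> carry l 0 = 0"
proof -
  have "(\<forall>x\<in>set l. fst x mod modulus (snd x) = fst x) \<Longrightarrow> digits l 0 = l \<and> carry l 0 = 0"
  proof (induction l)
    case (Cons x l)
    have "fst x div modulus (snd x) = 0"
      using div_mult_mod_eq[of "fst x" "modulus (snd x)"] Cons.prems modulus_nonzero[of "snd x"] by auto
    then show ?case using Cons by simp
  qed simp
  then show "normal l \<Longrightarrow> digits l 0 = l" "normal l \<Longrightarrow> carry l 0 = 0"
    by (simp_all add: normal_def)
qed

text \<open>
  A carry that crosses a stable letter is a multiple of the modulus on the far side of a cancelling pair,
  so it does not affect whether the pair is pinched.
\<close>

lemma pinched_digits:
  assumes "l \<noteq> []" "modulus (\<not> snd x) dvd k"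
  shows "pinched x (hd (digits l k)) = pinched x (hd l)"
  using assms by (cases l) (auto simp: pinched_def dvd_mod_iff dvd_add_left_iff)

lemma reduced_digits: "reduced (digits l k) = reduced l"
proof (induction l arbitrary: k)
  case (Cons x l)
  let ?k = "modulus (\<not> snd x) * ((fst x + k) div modulus (snd x))"
  have "pinched ((fst x + k) mod modulus (snd x), snd x) (hd (digits l ?k)) = pinched x (hd l)" if "l \<noteq> []"
    using pinched_digits[OF that, of "((fst x + k) mod modulus (snd x), snd x)" ?k] that
    by (simp add: pinched_def)
  moreover have "digits l ?k = [] \<longleftrightarrow> l = []"
    by (metis length_digits length_0_conv)
  ultimately show ?case by (auto simp: reduced_Cons Cons.IH)
qed (simp add: reduced_def)

lemma normal_digits:
  assumes "normal l"
  shows "normal (digits l k)"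
proof -
  have "\<forall>x\<in>set (digits l k). fst x mod modulus (snd x) = fst x"
    by (induction l arbitrary: k) auto
  then show ?thesis using assms by (simp add: normal_def reduced_digits)
qed

lemma normal_turn: "normal l \<Longrightarrow> normal (turn e l)"
  by (cases l) (auto simp: normal_def turn_def reduced_Cons reduced_Nil)

lemma turn_turn:
  assumes "normal l"
  shows "turn (\<not> e) (turn e l) = l"
proof (cases "l \<noteq> [] \<and> pinched (0, e) (hd l)")
  case True
  then obtain c l' where l: "l = (c, \<not> e) # l'"
    by (cases l) (auto simp: pinched_def)
  have "c mod modulus (\<not> e) = c" "modulus (\<not> e) dvd c"
    using True assms by (simp_all add: l normal_def pinched_def)
  then have "c = 0" by auto
  moreover have "l' \<noteq> [] \<Longrightarrow> \<not> pinched (0, \<not> e) (hd l')"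
    using assms pinched_cong[of "(0, \<not> e)" "(c, \<not> e)"] by (auto simp: l normal_def reduced_Cons)
  ultimately show ?thesis using True by (auto simp: l turn_def)
next
  case False
  then show ?thesis by (auto simp: turn_def pinched_def)
qed

text \<open>
  This is the defining relation, as an identity of operators on normal forms.
\<close>

lemma turn_digits:
  assumes "normal l"
  shows "turn e (digits l (modulus (\<not> e) * k)) = digits (turn e l) (modulus e * k)"
    and "carry l (modulus (\<not> e) * k) = carry (turn e l) (modulus e * k)"
proof -
  let ?d = "digits l (modulus (\<not> e) * k)"
  have "turn e ?d = digits (turn e l) (modulus e * k) \<and> carry l (modulus (\<not> e) * k) = carry (turn e l) (modulus e * k)"
  proof (cases "l \<noteq> [] \<and> pinched (0, e) (hd l)")
    case True
    then obtain c l' where l: "l = (c, \<not> e) # l'"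
      by (cases l) (auto simp: pinched_def)
    have "c mod modulus (\<not> e) = c" "modulus (\<not> e) dvd c"
      using True assms by (simp_all add: l normal_def pinched_def)
    then have c: "c = 0" by auto
    have "turn e l = l'" using True by (simp add: turn_def l)
    moreover have "turn e ?d = digits l' (modulus e * k)"
      using modulus_nonzero[of "\<not> e"] by (simp add: l c turn_def pinched_def)
    moreover have "carry l (modulus (\<not> e) * k) = carry l' (modulus e * k)"
      using modulus_nonzero[of "\<not> e"] by (simp add: l c)
    ultimately show ?thesis by simp
  next
    case False
    then have t: "turn e l = (0, e) # l" unfolding turn_def by auto
    have "\<not> (?d \<noteq> [] \<and> pinched (0, e) (hd ?d))"
      using False pinched_digits[of l "(0, e)" "modulus (\<not> e) * k"] by (metis length_digits length_0_conv snd_conv dvd_triv_left)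
    then have "turn e ?d = (0, e) # ?d" unfolding turn_def by auto
    then show ?thesis using modulus_nonzero[of e] by (simp add: t)
  qed
  then show "turn e ?d = digits (turn e l) (modulus e * k)"
    "carry l (modulus (\<not> e) * k) = carry (turn e l) (modulus e * k)" by auto
qed

definition letter_act where
  "letter_act p x = (if fst p = BS_a
     then (digits (fst x) (if snd p then 1 else -1), snd x + carry (fst x) (if snd p then 1 else -1))
     else (turn (snd p) (fst x), snd x))"

abbreviation "act \<equiv> foldr letter_act"

lemma normal_act: "normal (fst x) \<Longrightarrow> normal (fst (act w x))"
  by (induction w) (auto simp: letter_act_def normal_digits normal_turn)

lemma act_gen_pow_a:
  assumes "normal (fst x)"
  shows "act (gen_pow BS_a k) x = (digits (fst x) k, snd x + carry (fst x) k)"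
proof -
  have rep: "act (replicate i (BS_a, b)) x =
      (digits (fst x) (if b then int i else - int i), snd x + carry (fst x) (if b then int i else - int i))"
    for i b
  proof (induction i)
    case 0
    then show ?case using assms by (simp add: digits_0 carry_0)
  next
    case (Suc i)
    have e: "(if b then int (Suc i) else - int (Suc i)) =
        (if b then int i else - int i) + (if b then 1 else -1)" by simp
    show ?case
      unfolding e digits_add carry_add
      by (simp only: replicate_Suc foldr_Cons o_apply Suc) (simp add: letter_act_def add.assoc)
  qed
  show ?thesis unfolding gen_pow_def rep by simp
qed

lemma act_gen_pow_t: "act (gen_pow BS_t 1) x = (turn True (fst x), snd x)"
  "act (gen_pow BS_t (-1)) x = (turn False (fst x), snd x)"
  by (simp_all add: gen_pow_def letter_act_def)

abbreviation "Rel \<equiv> {(gen_pow BS_t 1 @ gen_pow BS_a m @ gen_pow BS_t (-1), gen_pow BS_a n)}"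

text \<open>
  Equal words act equally, since free cancellation and the relation hold for the operators. Hence
  the group acts on normal forms.
\<close>

lemma act_pres_eq:
  assumes "pres_eq Rel u v" "normal (fst x)"
  shows "act u x = act v x"
  using assms
proof (induction arbitrary: x)
  case (cancel u y s v)
  have "letter_act (y, s) (letter_act (y, \<not> s) z) = z" if z: "normal (fst z)" for z
  proof (cases y)
    case BS_a
    have "digits (fst z) (1 + -1) = fst z" "digits (fst z) (-1 + 1) = fst z"
      "carry (fst z) (1 + -1) = 0" "carry (fst z) (-1 + 1) = 0"
      using digits_0[OF z] carry_0[OF z] by simp_all
    then show ?thesis
      unfolding digits_add carry_add using BS_a by (cases z; cases s) (auto simp: letter_act_def)
  next
    case BS_t
    then show ?thesis using turn_turn[OF z, of "\<not> s"] by (simp add: letter_act_def)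
  qed
  then show ?case using normal_act[OF cancel] by simp
next
  case (rel l r u v)
  define z where "z = act v x"
  have z: "normal (fst z)" using normal_act[OF rel(2)] by (simp add: z_def)
  have "act (gen_pow BS_t 1 @ gen_pow BS_a m @ gen_pow BS_t (-1)) z =
      (turn True (digits (turn False (fst z)) m), snd z + carry (turn False (fst z)) m)"
    by (simp add: act_gen_pow_t act_gen_pow_a normal_turn z)
  also have "\<dots> = (digits (fst z) n, snd z + carry (fst z) n)"
    using turn_digits[OF normal_turn[OF z, of False], of True 1] turn_turn[OF z, of False]
    by (simp add: modulus_def)
  also have "\<dots> = act (gen_pow BS_a n) z" by (simp add: act_gen_pow_a z)
  finally show ?case using rel(1) by (simp add: z_def)
qed auto

end

section \<open>Syllables and Britton's lemma\<close>

context bs_forms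
begin

abbreviation "B \<equiv> BS m n"
abbreviation "\<alpha> \<equiv> word_class Rel [(BS_a, True)]"
abbreviation "\<tau> \<equiv> word_class Rel [(BS_t, True)]"

lemma group_B: "group B"
  by (simp add: BS_def group_presented_group)

sublocale group B by (rule group_B)

lemma word_class_closed: "word_class Rel w \<in> carrier B"
  by (simp add: BS_def carrier_presented_group)

sublocale bs_relation B \<alpha> \<tau> m n
proof
  show "\<alpha> \<in> carrier B" "\<tau> \<in> carrier B" by (rule word_class_closed)+
  have UNIV: "UNIV = {BS_a, BS_t}" using bs_gen.exhaust by blast
  have "range (\<lambda>x. word_class Rel [(x, True)]) = {\<alpha>, \<tau>}" by (simp add: UNIV)
  then show "generate B {\<alpha>, \<tau>} = carrier B"
    using generate_presented_group[of Rel] by (simp add: BS_def)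
  have "word_class Rel (gen_pow BS_t 1 @ gen_pow BS_a m @ gen_pow BS_t (-1)) = word_class Rel (gen_pow BS_a n)"
    by (rule word_class_rel) simp
  then have "\<tau> \<otimes>\<^bsub>B\<^esub> \<alpha> [^]\<^bsub>B\<^esub> m \<otimes>\<^bsub>B\<^esub> inv\<^bsub>B\<^esub> \<tau> = \<alpha> [^]\<^bsub>B\<^esub> n"
    by (simp only: word_class_conj_pow word_class_gen_pow BS_def)
  then show "\<tau> \<otimes>\<^bsub>B\<^esub> \<alpha> [^]\<^bsub>B\<^esub> m = \<alpha> [^]\<^bsub>B\<^esub> n \<otimes>\<^bsub>B\<^esub> \<tau>"
    using conj_eq_iff[of \<tau> "\<alpha> [^]\<^bsub>B\<^esub> m" "\<alpha> [^]\<^bsub>B\<^esub> n"] word_class_closed by simp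
qed

definition bs_act where
  "bs_act g x = act (SOME w. w \<in> g) x"

lemma bs_act_word_class:
  assumes "normal (fst x)"
  shows "bs_act (word_class Rel w) x = act w x"
proof -
  have "w \<in> word_class Rel w" by (simp add: word_class_def pres_eq.refl)
  then have "(SOME v. v \<in> word_class Rel w) \<in> word_class Rel w" by (rule someI)
  then show ?thesis
    using act_pres_eq[OF _ assms] by (simp add: bs_act_def word_class_def)
qed

lemma obtain_word:
  assumes "g \<in> carrier B"
  obtains w where "g = word_class Rel w"
  using assms by (auto simp: BS_def carrier_presented_group)

lemma normal_bs_act: "g \<in> carrier B \<Longrightarrow> normal (fst x) \<Longrightarrow> normal (fst (bs_act g x))"
  by (erule obtain_word) (simp add: bs_act_word_class normal_act)

lemma bs_act_mult:
  assumes "g \<in> carrier B" "h \<in> carrier B" "normal (fst x)"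
  shows "bs_act (g \<otimes>\<^bsub>B\<^esub> h) x = bs_act g (bs_act h x)"
proof -
  obtain u where u: "g = word_class Rel u" by (rule obtain_word[OF assms(1)])
  obtain v where v: "h = word_class Rel v" by (rule obtain_word[OF assms(2)])
  have "g \<otimes>\<^bsub>B\<^esub> h = word_class Rel (u @ v)"
    by (simp only: u v BS_def mult_presented_group)
  then show ?thesis by (simp add: u v bs_act_word_class assms(3) normal_act)
qed

lemma bs_act_one: "normal (fst x) \<Longrightarrow> bs_act \<one>\<^bsub>B\<^esub> x = x"
  by (simp add: BS_def one_presented_group bs_act_word_class)

lemma bs_act_\<alpha>_pow:
  assumes "normal l"
  shows "bs_act (\<alpha> [^]\<^bsub>B\<^esub> (k :: int)) (l, s) = (digits l k, s + carry l k)"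
proof -
  have "\<alpha> [^]\<^bsub>B\<^esub> k = word_class Rel (gen_pow BS_a k)"
    by (simp only: word_class_gen_pow BS_def)
  then show ?thesis by (simp only: bs_act_word_class assms fst_conv act_gen_pow_a) simp
qed

definition stable where
  "stable e = (if e then \<tau> else inv\<^bsub>B\<^esub> \<tau>)"

lemma stable_closed [simp]: "stable e \<in> carrier B"
  by (simp add: stable_def \<tau>)

lemma bs_act_stable:
  assumes "normal l"
  shows "bs_act (stable e) (l, s) = (turn e l, s)"
proof -
  have "inv\<^bsub>B\<^esub> \<tau> = word_class Rel [(BS_t, False)]"
    by (simp add: BS_def inv_presented_group inv_word_def)
  then have "stable e = word_class Rel [(BS_t, e)]" by (simp add: stable_def)
  then show ?thesis by (simp add: bs_act_word_class assms letter_act_def)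
qed

primrec word_prod :: "(int \<times> bool) list \<Rightarrow> bs_gen gword set" where
  "word_prod [] = \<one>\<^bsub>B\<^esub>"
| "word_prod (x # l) = \<alpha> [^]\<^bsub>B\<^esub> fst x \<otimes>\<^bsub>B\<^esub> stable (snd x) \<otimes>\<^bsub>B\<^esub> word_prod l"

lemma word_prod_closed [simp]: "word_prod l \<in> carrier B"
  by (induction l) (simp_all add: \<alpha>)

lemma \<alpha>_pow_closed [simp]: "\<alpha> [^]\<^bsub>B\<^esub> (k :: int) \<in> carrier B"
  by (simp add: \<alpha>)

lemma word_prod_append: "word_prod (l @ l') = word_prod l \<otimes>\<^bsub>B\<^esub> word_prod l'"
  by (induction l) (simp_all add: m_assoc)

lemma \<alpha>_pow_add: "\<alpha> [^]\<^bsub>B\<^esub> (i + j :: int) = \<alpha> [^]\<^bsub>B\<^esub> i \<otimes>\<^bsub>B\<^esub> \<alpha> [^]\<^bsub>B\<^esub> j"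
  by (simp add: int_pow_mult \<alpha>)

lemma stable_\<alpha>_pow: "stable e \<otimes>\<^bsub>B\<^esub> \<alpha> [^]\<^bsub>B\<^esub> (modulus (\<not> e) * k) = \<alpha> [^]\<^bsub>B\<^esub> (modulus e * k) \<otimes>\<^bsub>B\<^esub> stable e"
proof (cases e)
  case True
  then show ?thesis using bs_rel_mult[of k] by (simp add: stable_def modulus_def)
next
  case False
  have "inv\<^bsub>B\<^esub> \<tau> \<otimes>\<^bsub>B\<^esub> (\<alpha> [^]\<^bsub>B\<^esub> (n * k) \<otimes>\<^bsub>B\<^esub> \<tau>) \<otimes>\<^bsub>B\<^esub> inv\<^bsub>B\<^esub> \<tau>
      = inv\<^bsub>B\<^esub> \<tau> \<otimes>\<^bsub>B\<^esub> (\<tau> \<otimes>\<^bsub>B\<^esub> \<alpha> [^]\<^bsub>B\<^esub> (m * k)) \<otimes>\<^bsub>B\<^esub> inv\<^bsub>B\<^esub> \<tau>"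
    by (simp only: bs_rel_mult)
  moreover have "inv\<^bsub>B\<^esub> \<tau> \<otimes>\<^bsub>B\<^esub> (\<alpha> [^]\<^bsub>B\<^esub> (n * k) \<otimes>\<^bsub>B\<^esub> \<tau>) \<otimes>\<^bsub>B\<^esub> inv\<^bsub>B\<^esub> \<tau>
      = inv\<^bsub>B\<^esub> \<tau> \<otimes>\<^bsub>B\<^esub> \<alpha> [^]\<^bsub>B\<^esub> (n * k)"
    by (simp add: m_assoc \<tau>)
  moreover have "inv\<^bsub>B\<^esub> \<tau> \<otimes>\<^bsub>B\<^esub> (\<tau> \<otimes>\<^bsub>B\<^esub> \<alpha> [^]\<^bsub>B\<^esub> (m * k)) = \<alpha> [^]\<^bsub>B\<^esub> (m * k)"
    by (simp add: \<tau> flip: m_assoc)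
  ultimately show ?thesis using False by (simp add: stable_def modulus_def)
qed

lemma stable_cancel: "stable e \<otimes>\<^bsub>B\<^esub> stable (\<not> e) = \<one>\<^bsub>B\<^esub>"
  by (simp add: stable_def \<tau>)

lemma absorb_\<alpha>_pow:
  "\<exists>l' s. \<alpha> [^]\<^bsub>B\<^esub> (k :: int) \<otimes>\<^bsub>B\<^esub> word_prod l = word_prod l' \<otimes>\<^bsub>B\<^esub> \<alpha> [^]\<^bsub>B\<^esub> (s :: int) \<and>
     length l' = length l \<and> (l \<noteq> [] \<longrightarrow> s = 0)"
proof (cases l)
  case Nil
  then show ?thesis by (intro exI[of _ "[]"] exI[of _ k]) simp
next
  case (Cons x v)
  then show ?thesis
    by (intro exI[of _ "(k + fst x, snd x) # v"] exI[of _ 0])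
      (simp add: \<alpha>_pow_add m_assoc)
qed

lemma shorten:
  assumes "\<not> reduced l"
  shows "\<exists>l' s. word_prod l = word_prod l' \<otimes>\<^bsub>B\<^esub> \<alpha> [^]\<^bsub>B\<^esub> (s :: int) \<and> length l' < length l"
  using assms
proof (induction l)
  case (Cons x l)
  show ?case
  proof (cases "reduced l")
    case True
    then obtain y v where l: "l = y # v" and xy: "pinched x y"
      using Cons.prems by (cases l) (auto simp: reduced_Cons)
    have "modulus (\<not> snd x) dvd fst y" using xy unfolding pinched_def
      by (cases "snd x"; cases "snd y") simp_all
    then obtain k where k: "fst y = modulus (\<not> snd x) * k" by (rule dvdE)
    have "word_prod (x # l) = \<alpha> [^]\<^bsub>B\<^esub> fst x \<otimes>\<^bsub>B\<^esub> (stable (snd x) \<otimes>\<^bsub>B\<^esub> \<alpha> [^]\<^bsub>B\<^esub> (modulus (\<not> snd x) * k))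
        \<otimes>\<^bsub>B\<^esub> stable (\<not> snd x) \<otimes>\<^bsub>B\<^esub> word_prod v"
      using xy by (simp add: l k pinched_def m_assoc)
    also have "\<dots> = \<alpha> [^]\<^bsub>B\<^esub> fst x \<otimes>\<^bsub>B\<^esub> \<alpha> [^]\<^bsub>B\<^esub> (modulus (snd x) * k)
        \<otimes>\<^bsub>B\<^esub> (stable (snd x) \<otimes>\<^bsub>B\<^esub> stable (\<not> snd x)) \<otimes>\<^bsub>B\<^esub> word_prod v"
      unfolding stable_\<alpha>_pow by (simp add: m_assoc)
    also have "\<dots> = \<alpha> [^]\<^bsub>B\<^esub> (fst x + modulus (snd x) * k) \<otimes>\<^bsub>B\<^esub> word_prod v"
      by (simp add: stable_cancel \<alpha>_pow_add)
    finally have eq: "word_prod (x # l) = \<alpha> [^]\<^bsub>B\<^esub> (fst x + modulus (snd x) * k) \<otimes>\<^bsub>B\<^esub> word_prod v" .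
    obtain l' s where "\<alpha> [^]\<^bsub>B\<^esub> (fst x + modulus (snd x) * k) \<otimes>\<^bsub>B\<^esub> word_prod v = word_prod l' \<otimes>\<^bsub>B\<^esub> \<alpha> [^]\<^bsub>B\<^esub> (s :: int)"
      "length l' = length v"
      using absorb_\<alpha>_pow by blast
    then have "word_prod (x # l) = word_prod l' \<otimes>\<^bsub>B\<^esub> \<alpha> [^]\<^bsub>B\<^esub> s" "length l' < length (x # l)"
      by (simp_all only: eq) (simp add: l)
    then show ?thesis by blast
  next
    case False
    then obtain l' s where "word_prod l = word_prod l' \<otimes>\<^bsub>B\<^esub> \<alpha> [^]\<^bsub>B\<^esub> (s :: int)" "length l' < length l"
      using Cons.IH by blast
    then show ?thesis by (intro exI[of _ "x # l'"] exI[of _ s]) (simp add: m_assoc)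
  qed
qed (simp add: reduced_Nil)

lemma word_prod_exhaust:
  assumes "g \<in> carrier B"
  shows "\<exists>l s. g = word_prod l \<otimes>\<^bsub>B\<^esub> \<alpha> [^]\<^bsub>B\<^esub> (s :: int)"
proof -
  have "\<exists>l s. word_class Rel w = word_prod l \<otimes>\<^bsub>B\<^esub> \<alpha> [^]\<^bsub>B\<^esub> (s :: int)" for w
  proof (induction w)
    case Nil
    have "word_class Rel [] = \<one>\<^bsub>B\<^esub>" by (simp add: BS_def one_presented_group)
    then show ?case by (intro exI[of _ "[]"] exI[of _ 0]) simp
  next
    case (Cons p w)
    then obtain l s where w: "word_class Rel w = word_prod l \<otimes>\<^bsub>B\<^esub> \<alpha> [^]\<^bsub>B\<^esub> (s :: int)" by blast
    have pw: "word_class Rel (p # w) = word_class Rel [p] \<otimes>\<^bsub>B\<^esub> word_class Rel w"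
      by (simp add: BS_def mult_presented_group)
    obtain y e where p: "p = (y, e)" by (cases p)
    show ?case
    proof (cases y)
      case BS_a
      have "word_class Rel [p] = word_class Rel (gen_pow BS_a (if e then 1 else -1))"
        by (simp add: p BS_a gen_pow_def)
      then have "word_class Rel [p] = \<alpha> [^]\<^bsub>B\<^esub> (if e then 1 else -1 :: int)"
        by (simp only: word_class_gen_pow BS_def)
      moreover obtain l' s' where "\<alpha> [^]\<^bsub>B\<^esub> (if e then 1 else -1 :: int) \<otimes>\<^bsub>B\<^esub> word_prod l = word_prod l' \<otimes>\<^bsub>B\<^esub> \<alpha> [^]\<^bsub>B\<^esub> (s' :: int)"
        using absorb_\<alpha>_pow by blast
      ultimately have "word_class Rel (p # w) = word_prod l' \<otimes>\<^bsub>B\<^esub> \<alpha> [^]\<^bsub>B\<^esub> (s' + s)"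
        unfolding pw w by (simp add: \<alpha>_pow_add flip: m_assoc)
      then show ?thesis by blast
    next
      case BS_t
      have "inv\<^bsub>B\<^esub> \<tau> = word_class Rel [(BS_t, False)]"
        by (simp add: BS_def inv_presented_group inv_word_def)
      then have "word_class Rel [p] = stable e" by (simp add: p BS_t stable_def)
      then have "word_class Rel (p # w) = word_prod ((0, e) # l) \<otimes>\<^bsub>B\<^esub> \<alpha> [^]\<^bsub>B\<^esub> s"
        unfolding pw w by (simp add: m_assoc)
      then show ?thesis by blast
    qed
  qed
  then show ?thesis by (metis obtain_word[OF assms])
qed

lemma reduced_exhaust:
  assumes "g \<in> carrier B"
  shows "\<exists>l s. reduced l \<and> g = word_prod l \<otimes>\<^bsub>B\<^esub> \<alpha> [^]\<^bsub>B\<^esub> (s :: int)"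
proof -
  have "\<exists>l' s'. reduced l' \<and> word_prod l \<otimes>\<^bsub>B\<^esub> \<alpha> [^]\<^bsub>B\<^esub> s = word_prod l' \<otimes>\<^bsub>B\<^esub> \<alpha> [^]\<^bsub>B\<^esub> (s' :: int)"
    for l and s :: int
  proof (induction "length l" arbitrary: l s rule: less_induct)
    case less
    show ?case
    proof (cases "reduced l")
      case False
      then obtain l' s' where l': "word_prod l = word_prod l' \<otimes>\<^bsub>B\<^esub> \<alpha> [^]\<^bsub>B\<^esub> (s' :: int)" "length l' < length l"
        using shorten by blast
      have "word_prod l \<otimes>\<^bsub>B\<^esub> \<alpha> [^]\<^bsub>B\<^esub> s = word_prod l' \<otimes>\<^bsub>B\<^esub> \<alpha> [^]\<^bsub>B\<^esub> (s' + s)"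
        by (simp add: l'(1) \<alpha>_pow_add m_assoc)
      then show ?thesis using less[OF l'(2)] by metis
    qed blast
  qed
  then show ?thesis using word_prod_exhaust[OF assms] by metis
qed

lemma normal_Nil [simp]: "normal []"
  by (simp add: normal_def reduced_Nil)

lemma length_bs_act_word_prod:
  assumes "normal (fst x)"
  shows "length (fst (bs_act (word_prod l) x)) \<le> length l + length (fst x)"
proof (induction l)
  case (Cons y l)
  obtain v s where vs: "bs_act (word_prod l) x = (v, s)" by (cases "bs_act (word_prod l) x")
  have v: "normal v" using normal_bs_act[OF word_prod_closed assms, of l] by (simp add: vs)
  have "bs_act (word_prod (y # l)) x = (digits (turn (snd y) v) (fst y), s + carry (turn (snd y) v) (fst y))"
    by (simp add: bs_act_mult assms vs v bs_act_stable bs_act_\<alpha>_pow normal_turn)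
  moreover have "length (turn (snd y) v) \<le> Suc (length v)"
    by (auto simp: turn_def)
  ultimately show ?case using Cons by (simp add: length_digits vs)
qed (simp add: bs_act_one assms)

text \<open>
  Britton's lemma: acting on the trivial normal form, a reduced product never cancels, so it ends at
  a normal form of the same length. The induction also needs that the first syllable still
  cancels against the same stable letters.
\<close>

lemma bs_act_reduced_word_prod:
  assumes "reduced l"
  shows "length (fst (bs_act (word_prod l) ([], s))) = length l \<and>
    (l \<noteq> [] \<longrightarrow> (\<forall>x. pinched x (hd (fst (bs_act (word_prod l) ([], s)))) = pinched x (hd l)))"
  using assms
proof (induction l)
  case (Cons y l)
  obtain v s' where vs: "bs_act (word_prod l) ([], s) = (v, s')" by (cases "bs_act (word_prod l) ([], s)")
  have v: "normal v" using normal_bs_act[OF word_prod_closed, of "([], s)" l] by (simp add: vs)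
  have len: "length v = length l" using Cons by (simp add: vs reduced_Cons)
  have "\<not> (v \<noteq> [] \<and> pinched (0, snd y) (hd v))"
  proof
    assume a: "v \<noteq> [] \<and> pinched (0, snd y) (hd v)"
    then have "l \<noteq> []" using len by auto
    then have "pinched (0, snd y) (hd l)" using Cons a by (simp add: vs reduced_Cons)
    then show False
      using Cons.prems \<open>l \<noteq> []\<close> pinched_cong[of y "(0, snd y)"] by (simp add: reduced_Cons)
  qed
  then have t: "turn (snd y) v = (0, snd y) # v" unfolding turn_def by auto
  have "normal ((0, snd y) # v)" using normal_turn[OF v, of "snd y"] by (simp only: t)
  then have "bs_act (word_prod (y # l)) ([], s) =
      (digits ((0, snd y) # v) (fst y), s' + carry ((0, snd y) # v) (fst y))"
    by (simp add: bs_act_mult vs v bs_act_stable bs_act_\<alpha>_pow t del: digits.simps carry.simps)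
  then show ?case
    by (auto simp: length_digits len pinched_def dvd_mod_iff)
qed (simp add: bs_act_one)

end

section \<open>Powers of the base generator that fix a single vertex\<close>

context bs_forms
begin

lemma \<alpha>_pow_inj:
  fixes i j :: int
  assumes "\<alpha> [^]\<^bsub>B\<^esub> i = \<alpha> [^]\<^bsub>B\<^esub> j"
  shows "i = j"
proof -
  have "bs_act (\<alpha> [^]\<^bsub>B\<^esub> i) ([], 0) = bs_act (\<alpha> [^]\<^bsub>B\<^esub> j) ([], 0)"
    by (simp only: assms)
  then show ?thesis by (simp add: bs_act_\<alpha>_pow)
qed

text \<open>
  The action commutes with right multiplication by powers of \<open>\<alpha>\<close>.
\<close>

lemma bs_act_shift:
  assumes "g \<in> carrier B" "normal (fst x)"
  shows "bs_act g (fst x, snd x + z) = (fst (bs_act g x), snd (bs_act g x) + z)"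
proof -
  obtain w where "g = word_class Rel w" by (rule obtain_word[OF assms(1)])
  moreover have "act w (fst x, snd x + z) = (fst (act w x), snd (act w x) + z)"
    by (induction w) (auto simp: letter_act_def)
  ultimately show ?thesis by (simp add: bs_act_word_class assms(2))
qed

text \<open>
  If neither \<open>m\<close> nor \<open>n\<close> divides \<open>s\<close>, then \<open>\<alpha>\<^sup>s\<close> changes the first syllable of every normal form that
  has one. In terms of the Bass-Serre tree, \<open>\<alpha>\<^sup>s\<close> fixes only the base vertex. The hypothesis says
  that it also fixes the translate of the base vertex by the inverse of \<open>g\<close>.
\<close>

lemma mem_\<alpha>_if_conj_\<alpha>:
  fixes s s' :: int
  assumes g: "g \<in> carrier B" and conj: "g \<otimes>\<^bsub>B\<^esub> \<alpha> [^]\<^bsub>B\<^esub> s = \<alpha> [^]\<^bsub>B\<^esub> s' \<otimes>\<^bsub>B\<^esub> g"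
    and ndvd: "\<not> m dvd s" "\<not> n dvd s"
  shows "\<exists>r :: int. g = \<alpha> [^]\<^bsub>B\<^esub> r"
proof -
  define h where "h = inv\<^bsub>B\<^esub> g"
  have h: "h \<in> carrier B" using g by (simp add: h_def)
  have "h \<otimes>\<^bsub>B\<^esub> (g \<otimes>\<^bsub>B\<^esub> \<alpha> [^]\<^bsub>B\<^esub> s) \<otimes>\<^bsub>B\<^esub> h = h \<otimes>\<^bsub>B\<^esub> (\<alpha> [^]\<^bsub>B\<^esub> s' \<otimes>\<^bsub>B\<^esub> g) \<otimes>\<^bsub>B\<^esub> h"
    by (simp only: conj)
  moreover have "h \<otimes>\<^bsub>B\<^esub> (g \<otimes>\<^bsub>B\<^esub> \<alpha> [^]\<^bsub>B\<^esub> s) = \<alpha> [^]\<^bsub>B\<^esub> s"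
    using g by (simp add: h_def flip: m_assoc)
  moreover have "h \<otimes>\<^bsub>B\<^esub> (\<alpha> [^]\<^bsub>B\<^esub> s' \<otimes>\<^bsub>B\<^esub> g) \<otimes>\<^bsub>B\<^esub> h = h \<otimes>\<^bsub>B\<^esub> \<alpha> [^]\<^bsub>B\<^esub> s'"
    using g by (simp add: h_def m_assoc)
  ultimately have comm: "\<alpha> [^]\<^bsub>B\<^esub> s \<otimes>\<^bsub>B\<^esub> h = h \<otimes>\<^bsub>B\<^esub> \<alpha> [^]\<^bsub>B\<^esub> s'" by simp
  obtain l r where lr: "bs_act h ([], 0) = (l, r)" by (cases "bs_act h ([], 0)")
  have l: "normal l" using normal_bs_act[OF h, of "([], 0)"] by (simp add: lr)
  have "bs_act (\<alpha> [^]\<^bsub>B\<^esub> s \<otimes>\<^bsub>B\<^esub> h) ([], 0) = (digits l s, r + carry l s)"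
    by (simp add: bs_act_mult h lr l bs_act_\<alpha>_pow)
  moreover have "bs_act (h \<otimes>\<^bsub>B\<^esub> \<alpha> [^]\<^bsub>B\<^esub> s') ([], 0) = (l, r + s')"
    using bs_act_shift[OF h, of "([], 0)" s'] by (simp add: bs_act_mult h lr bs_act_\<alpha>_pow)
  ultimately have dig: "digits l s = l" by (simp add: comm)
  have "l = []"
  proof (rule ccontr)
    assume "l \<noteq> []"
    then obtain x v where xv: "l = x # v" by (cases l) auto
    have "(fst x + s) mod modulus (snd x) = fst x" "fst x mod modulus (snd x) = fst x"
      using dig l by (auto simp: xv normal_def prod_eq_iff)
    then have "(fst x + s) mod modulus (snd x) = fst x mod modulus (snd x)" by simp
    then have "modulus (snd x) dvd s" by (simp add: mod_eq_dvd_iff)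
    then show False using ndvd by (simp add: modulus_def split: if_splits)
  qed
  obtain l0 s0 where h0: "reduced l0" "h = word_prod l0 \<otimes>\<^bsub>B\<^esub> \<alpha> [^]\<^bsub>B\<^esub> (s0 :: int)"
    using reduced_exhaust[OF h] by blast
  have "bs_act (word_prod l0) ([], s0) = bs_act h ([], 0)"
    by (simp add: h0(2) bs_act_mult bs_act_\<alpha>_pow)
  then have "fst (bs_act (word_prod l0) ([], s0)) = l" by (simp add: lr)
  then have "length l0 = length l" using bs_act_reduced_word_prod[OF h0(1), of s0] by simp
  then have "h = \<alpha> [^]\<^bsub>B\<^esub> s0" using h0(2) \<open>l = []\<close> by simp
  then have "g = \<alpha> [^]\<^bsub>B\<^esub> (- s0)"
    using g \<alpha> by (simp add: int_pow_neg h_def) (metis h_def inv_inv)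
  then show ?thesis ..
qed

end

section \<open>Elliptic elements\<close>

context bs_forms
begin

definition conj_to where
  "conj_to g h \<longleftrightarrow> (\<exists>x\<in>carrier B. g = x \<otimes>\<^bsub>B\<^esub> h \<otimes>\<^bsub>B\<^esub> inv\<^bsub>B\<^esub> x)"

text \<open>
  The elements that fix a vertex of the Bass-Serre tree.
\<close>

definition elliptic where
  "elliptic g \<longleftrightarrow> (\<exists>i :: int. conj_to g (\<alpha> [^]\<^bsub>B\<^esub> i))"

lemma conj_to_trans:
  assumes "conj_to g h" "conj_to h k" "k \<in> carrier B"
  shows "conj_to g k"
proof -
  obtain x y where x: "x \<in> carrier B" "g = x \<otimes>\<^bsub>B\<^esub> h \<otimes>\<^bsub>B\<^esub> inv\<^bsub>B\<^esub> x"
    and y: "y \<in> carrier B" "h = y \<otimes>\<^bsub>B\<^esub> k \<otimes>\<^bsub>B\<^esub> inv\<^bsub>B\<^esub> y"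
    using assms(1,2) by (auto simp: conj_to_def)
  have "g = (x \<otimes>\<^bsub>B\<^esub> y) \<otimes>\<^bsub>B\<^esub> k \<otimes>\<^bsub>B\<^esub> inv\<^bsub>B\<^esub> (x \<otimes>\<^bsub>B\<^esub> y)"
    using x y assms(3) by (simp add: m_assoc inv_mult_group)
  then show ?thesis unfolding conj_to_def using x(1) y(1) by blast
qed

lemma conj_to_rotate:
  assumes "g \<in> carrier B" "h \<in> carrier B"
  shows "conj_to (g \<otimes>\<^bsub>B\<^esub> h) (h \<otimes>\<^bsub>B\<^esub> g)"
  unfolding conj_to_def using assms by (intro bexI[of _ g]) (simp_all add: m_assoc)

lemma elliptic_or_conj_word_prod:
  "elliptic (word_prod l \<otimes>\<^bsub>B\<^esub> \<alpha> [^]\<^bsub>B\<^esub> (s :: int)) \<or>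
   (\<exists>l'. conj_to (word_prod l \<otimes>\<^bsub>B\<^esub> \<alpha> [^]\<^bsub>B\<^esub> s) (word_prod l') \<and> length l' = length l)"
proof -
  have rot: "conj_to (word_prod l \<otimes>\<^bsub>B\<^esub> \<alpha> [^]\<^bsub>B\<^esub> s) (\<alpha> [^]\<^bsub>B\<^esub> s \<otimes>\<^bsub>B\<^esub> word_prod l)"
    by (rule conj_to_rotate) simp_all
  obtain l' z where l': "\<alpha> [^]\<^bsub>B\<^esub> s \<otimes>\<^bsub>B\<^esub> word_prod l = word_prod l' \<otimes>\<^bsub>B\<^esub> \<alpha> [^]\<^bsub>B\<^esub> (z :: int)"
    "length l' = length l" "l \<noteq> [] \<longrightarrow> z = 0"
    using absorb_\<alpha>_pow by blast
  show ?thesis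
  proof (cases "l = []")
    case True
    then show ?thesis using rot unfolding elliptic_def by auto
  next
    case False
    then show ?thesis using rot l' by auto
  qed
qed

lemma elliptic_conj: "conj_to g h \<Longrightarrow> elliptic h \<Longrightarrow> elliptic g"
  unfolding elliptic_def using conj_to_trans by fastforce

lemma elliptic_one: "elliptic \<one>\<^bsub>B\<^esub>"
  unfolding elliptic_def conj_to_def by (intro exI[of _ 0] bexI[of _ "\<one>\<^bsub>B\<^esub>"]) simp_all

text \<open>
  Take a conjugate with the least number of syllables. A pinched pair, within the product or across
  its ends after a rotation, would make it shorter.
\<close>

lemma cyclically_reduced_conj:
  assumes g: "g \<in> carrier B" and "\<not> elliptic g"
  shows "\<exists>l. conj_to g (word_prod l) \<and> l \<noteq> [] \<and> reduced l \<and> \<not> pinched (last l) (hd l)"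
proof -
  have conj_ex: "\<exists>l'. conj_to g (word_prod l') \<and> length l' = length l"
    if c: "conj_to g (word_prod l \<otimes>\<^bsub>B\<^esub> \<alpha> [^]\<^bsub>B\<^esub> (s :: int))" for l s
  proof -
    obtain l' where "conj_to (word_prod l \<otimes>\<^bsub>B\<^esub> \<alpha> [^]\<^bsub>B\<^esub> s) (word_prod l')" "length l' = length l"
      using elliptic_or_conj_word_prod[of l s] elliptic_conj[OF c] assms(2) by blast
    then show ?thesis using conj_to_trans[OF c _ word_prod_closed] by blast
  qed
  define P where "P l \<longleftrightarrow> conj_to g (word_prod l)" for l
  have "conj_to g g" unfolding conj_to_def using g by (intro bexI[of _ "\<one>\<^bsub>B\<^esub>"]) simp_all
  then have "\<exists>l. P l" using word_prod_exhaust[OF g] conj_ex unfolding P_def by metis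
  then obtain l where l: "P l" and min: "\<And>l'. P l' \<Longrightarrow> length l \<le> length l'"
    using arg_min_nat_lemma[of P _ length] by metis
  have red: "reduced l'" if "P l'" "length l' = length l" for l'
  proof (rule ccontr)
    assume "\<not> reduced l'"
    then obtain l2 s where "word_prod l' = word_prod l2 \<otimes>\<^bsub>B\<^esub> \<alpha> [^]\<^bsub>B\<^esub> (s :: int)" "length l2 < length l'"
      using shorten by blast
    then show False using conj_ex[of l2 s] that min unfolding P_def by fastforce
  qed
  have "l \<noteq> []"
    using l assms(2) elliptic_conj[OF _ elliptic_one] by (auto simp: P_def)
  moreover have "\<not> pinched (last l) (hd l)"
  proof -
    obtain u x where ux: "l = u @ [x]" using \<open>l \<noteq> []\<close> by (cases l rule: rev_cases) auto
    have "conj_to (word_prod u \<otimes>\<^bsub>B\<^esub> word_prod [x]) (word_prod [x] \<otimes>\<^bsub>B\<^esub> word_prod u)" by (rule conj_to_rotate) (rule word_prod_closed)+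
    then have "conj_to (word_prod l) (word_prod (x # u))" by (simp only: ux word_prod_append flip: word_prod_append) simp
    then have "P (x # u)" using l conj_to_trans[OF _ _ word_prod_closed] unfolding P_def by blast
    then have "reduced (x # u)" using red by (simp add: ux)
    then show ?thesis by (cases u) (auto simp: ux reduced_Cons pinched_def)
  qed
  ultimately show ?thesis using l red[OF l] unfolding P_def by blast
qed

lemma reduced_append:
  "reduced (u @ v) \<longleftrightarrow> reduced u \<and> reduced v \<and> (u = [] \<or> v = [] \<or> \<not> pinched (last u) (hd v))"
  by (auto simp: reduced_def successively_append_iff)

lemma length_bs_act_cyclic_pow:
  assumes "l \<noteq> []" "reduced l" "\<not> pinched (last l) (hd l)"
  shows "length (fst (bs_act (word_prod l [^]\<^bsub>B\<^esub> (N :: nat)) ([], s))) = N * length l"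
proof -
  have "reduced (concat (replicate N l)) \<and> (N > 0 \<longrightarrow> concat (replicate N l) \<noteq> [] \<and> hd (concat (replicate N l)) = hd l)"
    by (induction N) (use assms in \<open>auto simp: reduced_Nil reduced_append\<close>)
  moreover have "word_prod (concat (replicate N l)) = word_prod l [^]\<^bsub>B\<^esub> N"
    by (induction N) (simp_all add: word_prod_append nat_pow_Suc2 del: nat_pow_Suc Group.nat_pow_Suc)
  moreover have "length (concat (replicate N l)) = N * length l"
    by (induction N) simp_all
  ultimately show ?thesis using bs_act_reduced_word_prod[of "concat (replicate N l)" s] by simp
qed

text \<open>
  If \<open>g\<close> is not elliptic, it has a conjugate all of whose powers are reduced, so the length of
  \<open>g\<^sup>k\<close> is \<open>k\<close> times the length of that conjugate, up to a bounded error. Conjugation by \<open>u\<close>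
  changes lengths by a bounded amount, whereas \<open>g\<^bsup>xN\<^esup>\<close> and \<open>g\<^bsup>yN\<^esup>\<close> differ in length by at least \<open>N\<close>.
\<close>

lemma elliptic_if_nat_pow_conj:
  fixes x y :: nat
  assumes g: "g \<in> carrier B" and u: "u \<in> carrier B" and "x < y"
    and conj: "u \<otimes>\<^bsub>B\<^esub> g [^]\<^bsub>B\<^esub> x \<otimes>\<^bsub>B\<^esub> inv\<^bsub>B\<^esub> u = g [^]\<^bsub>B\<^esub> y"
  shows "elliptic g"
proof (rule ccontr)
  assume "\<not> elliptic g"
  then obtain l where l: "conj_to g (word_prod l)" "l \<noteq> []" "reduced l" "\<not> pinched (last l) (hd l)"
    using cyclically_reduced_conj[OF g] by blast
  then obtain h where h: "h \<in> carrier B" "g = h \<otimes>\<^bsub>B\<^esub> word_prod l \<otimes>\<^bsub>B\<^esub> inv\<^bsub>B\<^esub> h"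
    by (auto simp: conj_to_def)
  define w where "w = inv\<^bsub>B\<^esub> h \<otimes>\<^bsub>B\<^esub> u \<otimes>\<^bsub>B\<^esub> h"
  have w: "w \<in> carrier B" using h u by (simp add: w_def)
  have g_pow: "g [^]\<^bsub>B\<^esub> k = h \<otimes>\<^bsub>B\<^esub> word_prod l [^]\<^bsub>B\<^esub> k \<otimes>\<^bsub>B\<^esub> inv\<^bsub>B\<^esub> h" for k :: nat
    using conj_int_pow[OF h(1), of "word_prod l" "int k"] by (simp add: h(2) int_pow_int)
  have "inv\<^bsub>B\<^esub> h \<otimes>\<^bsub>B\<^esub> (u \<otimes>\<^bsub>B\<^esub> g [^]\<^bsub>B\<^esub> x \<otimes>\<^bsub>B\<^esub> inv\<^bsub>B\<^esub> u) \<otimes>\<^bsub>B\<^esub> h = inv\<^bsub>B\<^esub> h \<otimes>\<^bsub>B\<^esub> g [^]\<^bsub>B\<^esub> y \<otimes>\<^bsub>B\<^esub> h"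
    by (simp only: conj)
  moreover have "inv\<^bsub>B\<^esub> h \<otimes>\<^bsub>B\<^esub> (u \<otimes>\<^bsub>B\<^esub> g [^]\<^bsub>B\<^esub> x \<otimes>\<^bsub>B\<^esub> inv\<^bsub>B\<^esub> u) \<otimes>\<^bsub>B\<^esub> h = w \<otimes>\<^bsub>B\<^esub> word_prod l [^]\<^bsub>B\<^esub> x \<otimes>\<^bsub>B\<^esub> inv\<^bsub>B\<^esub> w"
    using h(1) u by (simp add: g_pow w_def inv_mult_group m_assoc)
  moreover have "inv\<^bsub>B\<^esub> h \<otimes>\<^bsub>B\<^esub> g [^]\<^bsub>B\<^esub> y \<otimes>\<^bsub>B\<^esub> h = word_prod l [^]\<^bsub>B\<^esub> y"
    using h(1) by (simp add: g_pow m_assoc) (simp flip: m_assoc)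
  ultimately have conj': "w \<otimes>\<^bsub>B\<^esub> word_prod l [^]\<^bsub>B\<^esub> x \<otimes>\<^bsub>B\<^esub> inv\<^bsub>B\<^esub> w = word_prod l [^]\<^bsub>B\<^esub> y" by simp
  obtain l1 s1 where l1: "w = word_prod l1 \<otimes>\<^bsub>B\<^esub> \<alpha> [^]\<^bsub>B\<^esub> (s1 :: int)" using word_prod_exhaust[OF w] by blast
  obtain l2 s2 where l2: "inv\<^bsub>B\<^esub> w = word_prod l2 \<otimes>\<^bsub>B\<^esub> \<alpha> [^]\<^bsub>B\<^esub> (s2 :: int)"
    using word_prod_exhaust[OF inv_closed[OF w]] by blast
  have len: "length (fst (bs_act (word_prod v \<otimes>\<^bsub>B\<^esub> \<alpha> [^]\<^bsub>B\<^esub> (s :: int)) z)) \<le> length v + length (fst z)"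
    if "normal (fst z)" for v s z
    using length_bs_act_word_prod[of "bs_act (\<alpha> [^]\<^bsub>B\<^esub> s) z" v] that
    by (cases z) (simp add: bs_act_mult bs_act_\<alpha>_pow normal_digits length_digits)
  have len_pow: "length (fst (bs_act (word_prod l [^]\<^bsub>B\<^esub> k) z)) \<le> k * length l + length (fst z)"
    if "normal (fst z)" for k :: nat and z
  proof (induction k)
    case (Suc k)
    have "length (fst (bs_act (word_prod l [^]\<^bsub>B\<^esub> Suc k) z)) = length (fst (bs_act (word_prod l) (bs_act (word_prod l [^]\<^bsub>B\<^esub> k) z)))"
      using that by (simp add: nat_pow_Suc2 bs_act_mult del: nat_pow_Suc Group.nat_pow_Suc)
    also have "\<dots> \<le> length l + length (fst (bs_act (word_prod l [^]\<^bsub>B\<^esub> k) z))"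
      using that by (intro length_bs_act_word_prod normal_bs_act) simp_all
    finally show ?case using Suc by simp
  qed (simp add: bs_act_one that)
  define N where "N = length l1 + length l2 + 1"
  have "w \<otimes>\<^bsub>B\<^esub> word_prod l [^]\<^bsub>B\<^esub> (x * N) \<otimes>\<^bsub>B\<^esub> inv\<^bsub>B\<^esub> w = word_prod l [^]\<^bsub>B\<^esub> (y * N)"
    using conj_int_pow[OF w, of "word_prod l [^]\<^bsub>B\<^esub> x" "int N"] conj' by (simp add: int_pow_int nat_pow_pow)
  then have "y * N * length l = length (fst (bs_act (w \<otimes>\<^bsub>B\<^esub> word_prod l [^]\<^bsub>B\<^esub> (x * N) \<otimes>\<^bsub>B\<^esub> inv\<^bsub>B\<^esub> w) ([], 0)))"
    using length_bs_act_cyclic_pow[OF l(2-4), of "y * N" 0] by simp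
  also have "\<dots> = length (fst (bs_act w (bs_act (word_prod l [^]\<^bsub>B\<^esub> (x * N)) (bs_act (inv\<^bsub>B\<^esub> w) ([], 0)))))"
    using w by (simp add: bs_act_mult normal_bs_act)
  also have "\<dots> \<le> length l1 + (x * N * length l + length l2)"
  proof -
    have z: "normal (fst (bs_act (inv\<^bsub>B\<^esub> w) ([], 0)))" using w by (simp add: normal_bs_act)
    have "length (fst (bs_act (inv\<^bsub>B\<^esub> w) ([], 0))) \<le> length l2"
      using len[of "([], 0)" l2 s2] by (simp add: l2)
    then have "length (fst (bs_act (word_prod l [^]\<^bsub>B\<^esub> (x * N)) (bs_act (inv\<^bsub>B\<^esub> w) ([], 0)))) \<le> x * N * length l + length l2"
      using len_pow[OF z, of "x * N"] by linarith
    moreover have "normal (fst (bs_act (word_prod l [^]\<^bsub>B\<^esub> (x * N)) (bs_act (inv\<^bsub>B\<^esub> w) ([], 0))))"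
      using z by (simp add: normal_bs_act)
    ultimately show ?thesis using len[of _ l1 s1] unfolding l1[symmetric] by (meson add_left_mono order.trans)
  qed
  also have "\<dots> < N + x * N * length l" by (simp add: N_def)
  also have "\<dots> \<le> N * length l + x * N * length l"
    using l(2) by (cases l) simp_all
  also have "\<dots> = (x + 1) * (N * length l)" by (simp add: algebra_simps)
  also have "\<dots> \<le> y * (N * length l)"
    using \<open>x < y\<close> by (intro mult_right_mono) auto
  finally show False by (simp add: mult.assoc)
qed

text \<open>
  Conjugating twice replaces \<open>x, y\<close> by their squares, which removes the signs.
\<close>

lemma elliptic_if_pow_conj:
  fixes x y :: int
  assumes g: "g \<in> carrier B" and u: "u \<in> carrier B" and "\<bar>x\<bar> \<noteq> \<bar>y\<bar>"
    and conj: "u \<otimes>\<^bsub>B\<^esub> g [^]\<^bsub>B\<^esub> x \<otimes>\<^bsub>B\<^esub> inv\<^bsub>B\<^esub> u = g [^]\<^bsub>B\<^esub> y"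
  shows "elliptic g"
proof -
  have mult: "u \<otimes>\<^bsub>B\<^esub> g [^]\<^bsub>B\<^esub> (x * z) \<otimes>\<^bsub>B\<^esub> inv\<^bsub>B\<^esub> u = g [^]\<^bsub>B\<^esub> (y * z)" for z :: int
    using conj_int_pow[OF u, of "g [^]\<^bsub>B\<^esub> x" z] conj g by (simp add: int_pow_pow)
  let ?v = "u \<otimes>\<^bsub>B\<^esub> u"
  have v: "?v \<in> carrier B" using u by simp
  have "?v \<otimes>\<^bsub>B\<^esub> g [^]\<^bsub>B\<^esub> (x * x) \<otimes>\<^bsub>B\<^esub> inv\<^bsub>B\<^esub> ?v
      = u \<otimes>\<^bsub>B\<^esub> (u \<otimes>\<^bsub>B\<^esub> g [^]\<^bsub>B\<^esub> (x * x) \<otimes>\<^bsub>B\<^esub> inv\<^bsub>B\<^esub> u) \<otimes>\<^bsub>B\<^esub> inv\<^bsub>B\<^esub> u"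
    using u g by (simp add: inv_mult_group m_assoc)
  also have "\<dots> = g [^]\<^bsub>B\<^esub> (y * y)"
    using mult[of x] mult[of y] by (simp add: mult.commute)
  finally have sq: "?v \<otimes>\<^bsub>B\<^esub> g [^]\<^bsub>B\<^esub> (x * x) \<otimes>\<^bsub>B\<^esub> inv\<^bsub>B\<^esub> ?v = g [^]\<^bsub>B\<^esub> (y * y)" .
  have sq': "inv\<^bsub>B\<^esub> ?v \<otimes>\<^bsub>B\<^esub> g [^]\<^bsub>B\<^esub> (y * y) \<otimes>\<^bsub>B\<^esub> inv\<^bsub>B\<^esub> (inv\<^bsub>B\<^esub> ?v) = g [^]\<^bsub>B\<^esub> (x * x)"
    unfolding sq[symmetric] using v g by (simp add: m_assoc) (simp flip: m_assoc)
  define a b where "a = nat (x * x)" and "b = nat (y * y)"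
  have ab: "x * x = int a" "y * y = int b" by (simp_all add: a_def b_def)
  have "x * x \<noteq> y * y" using assms(3) by (auto simp: power2_eq_iff simp flip: power2_eq_square)
  then have "a < b \<or> b < a" by (auto simp: ab)
  then show ?thesis
    using elliptic_if_nat_pow_conj[OF g v _ sq[unfolded ab int_pow_int]]
      elliptic_if_nat_pow_conj[OF g inv_closed[OF v] _ sq'[unfolded ab int_pow_int]] by blast
qed

end

section \<open>The obstruction to generating triples\<close>

lemma (in group) lollipop_triple_swap:
  assumes "lollipop_triple G Q R X Y a b t"
  shows "lollipop_triple G Q R Y X a b (inv t)"
proof -
  have abt: "a \<in> carrier G" "b \<in> carrier G" "t \<in> carrier G" "a [^] Q = b [^] R"
    and t: "t \<otimes> b [^] X = b [^] Y \<otimes> t"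
    using assms conj_eq_iff[of t "b [^] X" "b [^] Y"] by (auto simp: lollipop_triple_def)
  have "inv t \<otimes> (b [^] Y \<otimes> t) \<otimes> inv t = inv t \<otimes> (t \<otimes> b [^] X) \<otimes> inv t"
    by (simp only: t)
  moreover have "inv t \<otimes> (b [^] Y \<otimes> t) \<otimes> inv t = inv t \<otimes> b [^] Y"
    using abt by (simp add: m_assoc)
  moreover have "inv t \<otimes> (t \<otimes> b [^] X) = b [^] X"
    using abt by (simp flip: m_assoc)
  ultimately show ?thesis
    using abt by (intro lollipop_tripleI) simp_all
qed

lemma (in group) generate_inv_last:
  assumes "a \<in> carrier G" "b \<in> carrier G" "t \<in> carrier G"
  shows "generate G {a, b, inv t} = generate G {a, b, t}"
proof -
  have "generate G {a, b, inv s} \<subseteq> generate G {a, b, s}" if "s \<in> carrier G" for s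
  proof (rule generate_subgroup_incl)
    show "subgroup (generate G {a, b, s}) G"
      by (rule generate_is_subgroup) (use assms that in auto)
    show "{a, b, inv s} \<subseteq> generate G {a, b, s}"
      by (auto intro: generate.incl generate.inv)
  qed
  from this[of t] this[of "inv t"] show ?thesis using assms by simp
qed

lemma lollipop_triple_mod:
  assumes G: "group G" and \<chi>: "\<chi> \<in> hom G (integer_mod_group r)"
    and abt: "lollipop_triple G Q R X Y a b t"
  shows "[Q * \<chi> a = R * \<chi> b] (mod int r)" and "[X * \<chi> b = Y * \<chi> b] (mod int r)"
proof -
  have tr: "lollipop_triple (integer_mod_group r) Q R X Y (\<chi> a) (\<chi> b) (\<chi> t)"
    by (rule lollipop_triple_hom[OF G group_integer_mod_group \<chi> abt])
  then show "[Q * \<chi> a = R * \<chi> b] (mod int r)"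
    by (simp add: lollipop_triple_def int_pow_integer_mod_group cong_def)
  have "\<chi> t \<in> carrier (integer_mod_group r)"
    using tr by (simp add: lollipop_triple_def)
  then have "inv\<^bsub>integer_mod_group r\<^esub> \<chi> t = (- \<chi> t) mod int r"
    by (rule inv_integer_mod_group)
  then have "[\<chi> t + X * \<chi> b + - \<chi> t = Y * \<chi> b] (mod int r)"
    using tr by (simp add: lollipop_triple_def int_pow_integer_mod_group cong_def mod_simps)
  then show "[X * \<chi> b = Y * \<chi> b] (mod int r)" by simp
qed

context bs_forms
begin

lemma hom_mod_exists:
  assumes "int r dvd m" "int r dvd n" "u \<in> carrier (integer_mod_group r)" "w \<in> carrier (integer_mod_group r)"
  shows "\<exists>\<chi>\<in>hom B (integer_mod_group r). \<chi> \<alpha> = u \<and> \<chi> \<tau> = w"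
proof -
  let ?Z = "integer_mod_group r"
  define f where "f x = (case x of BS_a \<Rightarrow> u | BS_t \<Rightarrow> w)" for x
  have f_simps: "f BS_a = u" "f BS_t = w" by (simp_all add: f_def)
  have f: "f x \<in> carrier ?Z" for x using assms by (cases x) (auto simp: f_def)
  have Z: "group ?Z" by simp
  interpret Z: group ?Z by simp
  have pow0: "u [^]\<^bsub>?Z\<^esub> m = 0" "u [^]\<^bsub>?Z\<^esub> n = 0"
    using assms(1,2) by (simp_all add: int_pow_integer_mod_group)
  have "w \<otimes>\<^bsub>?Z\<^esub> inv\<^bsub>?Z\<^esub> w = \<one>\<^bsub>?Z\<^esub>" by (rule Z.r_inv[OF assms(4)])
  then have "w \<otimes>\<^bsub>?Z\<^esub> u [^]\<^bsub>?Z\<^esub> m \<otimes>\<^bsub>?Z\<^esub> inv\<^bsub>?Z\<^esub> w = u [^]\<^bsub>?Z\<^esub> n"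
    using Z.r_one[OF assms(4)] by (simp only: pow0 one_integer_mod_group)
  then have "\<exists>h\<in>hom (presented_group Rel) ?Z. \<forall>w. h (word_class Rel w) = word_eval ?Z f w"
    using assms(3,4)
    by (intro presented_group_universal[OF Z f])
      (auto simp: word_eval_append[OF Z f] word_eval_gen_pow[OF Z f] f_simps Z.int_pow_neg Z.m_assoc
        simp del: mult_integer_mod_group inv_integer_mod_group)
  then obtain h where h: "h \<in> hom B ?Z" "\<And>w. h (word_class Rel w) = word_eval ?Z f w"
    unfolding BS_def by blast
  have "h \<alpha> = u" "h \<tau> = w"
    using Z.r_one[OF assms(3)] Z.r_one[OF assms(4)] by (simp_all only: h(2) word_eval.simps fst_conv snd_conv if_True f_simps)
  then show ?thesis using h(1) by blast
qed

text \<open>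
  Since \<open>r\<close> divides \<open>m\<close> and \<open>n\<close>, the group maps onto the square of the cyclic group of order \<open>r\<close>.
  If \<open>a\<close> and \<open>b\<close> vanished in every cyclic quotient of order \<open>r\<close>, the single element \<open>t\<close> would generate
  that square.
\<close>

lemma generators_survive_mod:
  assumes r: "r > 1" "int r dvd m" "int r dvd n"
    and abt: "a \<in> carrier B" "b \<in> carrier B" "t \<in> carrier B" "generate B {a, b, t} = carrier B"
    and kill: "\<And>\<chi>. \<chi> \<in> hom B (integer_mod_group r) \<Longrightarrow> \<chi> a = 0 \<and> \<chi> b = 0"
  shows False
proof -
  let ?Z = "integer_mod_group r"
  have "0 \<in> carrier ?Z" "1 \<in> carrier ?Z" using r(1) by auto
  then obtain \<chi> \<psi> where \<chi>: "\<chi> \<in> hom B ?Z" "\<chi> \<alpha> = 1" "\<chi> \<tau> = 0" and \<psi>: "\<psi> \<in> hom B ?Z" "\<psi> \<alpha> = 0" "\<psi> \<tau> = 1"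
    using hom_mod_exists[OF r(2,3)] by metis
  have mult: "[\<phi> (g \<otimes>\<^bsub>B\<^esub> h) = \<phi> g + \<phi> h] (mod int r)" "[\<phi> (inv\<^bsub>B\<^esub> g) = - \<phi> g] (mod int r)"
    if "\<phi> \<in> hom B ?Z" "g \<in> carrier B" "h \<in> carrier B" for \<phi> g h
  proof -
    interpret \<phi>: group_hom B ?Z \<phi>
      by (rule group_hom.intro[OF group_B]) (simp_all add: group_hom_axioms_def that(1))
    show "[\<phi> (g \<otimes>\<^bsub>B\<^esub> h) = \<phi> g + \<phi> h] (mod int r)"
      using \<phi>.hom_mult[OF that(2,3)] by (simp add: cong_def)
    show "[\<phi> (inv\<^bsub>B\<^esub> g) = - \<phi> g] (mod int r)"
      using \<phi>.hom_inv[OF that(2)] \<phi>.hom_closed[OF that(2)] by (simp add: cong_def)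
  qed
  have "\<exists>k. [\<chi> g = k * \<chi> t] (mod int r) \<and> [\<psi> g = k * \<psi> t] (mod int r)"
    if "g \<in> generate B {a, b, t}" for g
    using that
  proof induction
    case one
    have "\<chi> \<one>\<^bsub>B\<^esub> = 0" "\<psi> \<one>\<^bsub>B\<^esub> = 0"
      using hom_one[OF \<chi>(1) group_B] hom_one[OF \<psi>(1) group_B] by simp_all
    then show ?case by (intro exI[of _ 0]) simp
  next
    case (incl g)
    then consider "g = t" | "\<chi> g = 0" "\<psi> g = 0" using kill[OF \<chi>(1)] kill[OF \<psi>(1)] by auto
    then show ?case
    proof cases
      case 1
      then show ?thesis by (intro exI[of _ 1]) simp
    next
      case 2
      then show ?thesis by (intro exI[of _ 0]) simp
    qed
  next
    case (inv g)
    have g: "g \<in> carrier B" using inv abt by auto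
    from inv consider "g = t" | "\<chi> g = 0" "\<psi> g = 0" using kill[OF \<chi>(1)] kill[OF \<psi>(1)] by auto
    then show ?case
    proof cases
      case 1
      then show ?thesis using mult(2)[OF \<chi>(1) g g] mult(2)[OF \<psi>(1) g g] by (intro exI[of _ "-1"]) simp
    next
      case 2
      then show ?thesis using mult(2)[OF \<chi>(1) g g] mult(2)[OF \<psi>(1) g g] by (intro exI[of _ 0]) simp
    qed
  next
    case (eng g h)
    then obtain k j where k: "[\<chi> g = k * \<chi> t] (mod int r)" "[\<psi> g = k * \<psi> t] (mod int r)"
      and j: "[\<chi> h = j * \<chi> t] (mod int r)" "[\<psi> h = j * \<psi> t] (mod int r)" by blast
    have gh: "g \<in> carrier B" "h \<in> carrier B" using eng.hyps abt(4) by auto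
    show ?case
      using cong_trans[OF mult(1)[OF \<chi>(1) gh] cong_add[OF k(1) j(1)]]
        cong_trans[OF mult(1)[OF \<psi>(1) gh] cong_add[OF k(2) j(2)]]
      by (intro exI[of _ "k + j"]) (simp add: distrib_right)
  qed
  then obtain k j where k: "[1 = k * \<chi> t] (mod int r)" "[0 = k * \<psi> t] (mod int r)"
    and j: "[0 = j * \<chi> t] (mod int r)" "[1 = j * \<psi> t] (mod int r)"
    using \<chi>(2,3) \<psi>(2,3) abt(4) \<alpha> \<tau> by metis
  \<comment> \<open>The vectors (1, 0) and (0, 1) are multiples of one vector, so their determinant vanishes.\<close>
  have "[1 * 1 = (k * \<chi> t) * (j * \<psi> t)] (mod int r)" by (rule cong_mult[OF k(1) j(2)])
  moreover have "[0 * 0 = (k * \<psi> t) * (j * \<chi> t)] (mod int r)" by (rule cong_mult[OF k(2) j(1)])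
  ultimately have "[1 = 0] (mod int r)" by (simp add: cong_def mult_ac)
  then show False using r(1) by (simp add: cong_def)
qed

text \<open>
  The disjunction on \<open>m, n\<close> makes the lemma symmetric under the exchange of \<open>X\<close> and \<open>Y\<close>, which amounts to inverting
  \<open>t\<close>, without changing the target group.
\<close>

lemma no_generating_lollipop_triple:
  fixes p q :: nat and Q R X Y :: int
  assumes mn: "(m = Q * X \<and> n = Q * Y) \<or> (m = Q * Y \<and> n = Q * X)"
    and abt: "lollipop_triple B Q R X Y a b t" and gen_abt: "generate B {a, b, t} = carrier B"
    and p: "prime p" "int p dvd Q" "int p dvd R" "int p dvd Y" "\<not> int p dvd X"
    and q: "prime q" "int q dvd X" "int q dvd Q * Y" "\<not> (int q dvd R \<and> int q dvd Y)"
  shows False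
proof -
  have a: "a \<in> carrier B" and b: "b \<in> carrier B" and t: "t \<in> carrier B"
    and ab: "a [^]\<^bsub>B\<^esub> Q = b [^]\<^bsub>B\<^esub> R" and tb: "t \<otimes>\<^bsub>B\<^esub> b [^]\<^bsub>B\<^esub> X \<otimes>\<^bsub>B\<^esub> inv\<^bsub>B\<^esub> t = b [^]\<^bsub>B\<^esub> Y"
    using abt by (auto simp: lollipop_triple_def)
  have Q0: "Q \<noteq> 0" using mn m_nonzero by auto
  have "\<bar>X\<bar> \<noteq> \<bar>Y\<bar>" using p(4,5) by (metis dvd_abs_iff)
  then have "\<bar>Q * X\<bar> \<noteq> \<bar>Q * Y\<bar>" using Q0 by (simp add: abs_mult)
  moreover have "t \<otimes>\<^bsub>B\<^esub> a [^]\<^bsub>B\<^esub> (Q * X) \<otimes>\<^bsub>B\<^esub> inv\<^bsub>B\<^esub> t = a [^]\<^bsub>B\<^esub> (Q * Y)"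
  proof -
    have "a [^]\<^bsub>B\<^esub> (Q * k) = (b [^]\<^bsub>B\<^esub> k) [^]\<^bsub>B\<^esub> R" for k :: int
    proof -
      have "a [^]\<^bsub>B\<^esub> (Q * k) = (b [^]\<^bsub>B\<^esub> R) [^]\<^bsub>B\<^esub> k"
        using a by (simp add: int_pow_pow flip: ab)
      then show ?thesis using b by (simp add: int_pow_pow mult.commute)
    qed
    then show ?thesis using conj_int_pow[OF t, of "b [^]\<^bsub>B\<^esub> X" R] b by (simp add: tb)
  qed
  \<comment> \<open>In the target group \<open>t\<close> conjugates \<open>a\<^bsup>QX\<^esup> = b\<^bsup>RX\<^esup>\<close> to \<open>b\<^bsup>RY\<^esup> = a\<^bsup>QY\<^esup>\<close>.\<close>
  ultimately have "elliptic a" by (intro elliptic_if_pow_conj[OF a t])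
  then obtain h i where h: "h \<in> carrier B" and a_eq: "a = h \<otimes>\<^bsub>B\<^esub> \<alpha> [^]\<^bsub>B\<^esub> (i :: int) \<otimes>\<^bsub>B\<^esub> inv\<^bsub>B\<^esub> h"
    by (auto simp: elliptic_def conj_to_def)
  have \<chi>_a: "\<chi> a = 0" if \<chi>: "\<chi> \<in> hom B (integer_mod_group r)" and "int r dvd i" "r > 0" for \<chi> and r :: nat
  proof -
    interpret \<chi>: group_hom B "integer_mod_group r" \<chi>
      by (rule group_hom.intro[OF group_B]) (simp_all add: group_hom_axioms_def \<chi>)
    have "\<chi> (\<alpha> [^]\<^bsub>B\<^esub> i) = \<one>\<^bsub>integer_mod_group r\<^esub>"
      using that(2) \<alpha> by (simp add: \<chi>.hom_int_pow int_pow_integer_mod_group)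
    then have "\<chi> a = \<chi> h \<otimes>\<^bsub>integer_mod_group r\<^esub> \<one>\<^bsub>integer_mod_group r\<^esub> \<otimes>\<^bsub>integer_mod_group r\<^esub> inv\<^bsub>integer_mod_group r\<^esub> (\<chi> h)"
      unfolding a_eq using h by (simp del: mult_integer_mod_group inv_integer_mod_group one_integer_mod_group)
    also have "\<dots> = \<one>\<^bsub>integer_mod_group r\<^esub>"
      using h by (simp del: mult_integer_mod_group inv_integer_mod_group one_integer_mod_group)
    finally show ?thesis by simp
  qed
  have range: "\<chi> b \<in> {0..<int r}" if "\<chi> \<in> hom B (integer_mod_group r)" "r > 0" for \<chi> and r :: nat
    using that b by (auto simp: hom_def Pi_iff carrier_integer_mod_group)
  have \<chi>_b: "\<chi> b = 0" if \<chi>: "\<chi> \<in> hom B (integer_mod_group r)" and "int r dvd k * \<chi> b" "prime r" "\<not> int r dvd k"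
    for \<chi> k and r :: nat
  proof -
    have "int r dvd \<chi> b" using that by (simp add: prime_dvd_mult_iff)
    then show ?thesis
      using range[OF \<chi>] prime_gt_0_nat[OF that(3)] zdvd_not_zless[of "\<chi> b" "int r"] by force
  qed
  have p_i: "\<not> int p dvd i"
  proof
    assume pi: "int p dvd i"
    show False
    proof (rule generators_survive_mod[OF _ _ _ a b t gen_abt])
      show "p > 1" using prime_gt_1_nat[OF p(1)] .
      show "int p dvd m" "int p dvd n" using mn p(2) by auto
      fix \<chi> assume \<chi>: "\<chi> \<in> hom B (integer_mod_group p)"
      have "int p dvd X * \<chi> b"
        using lollipop_triple_mod(2)[OF group_B \<chi> abt] p(4) cong_dvd_iff dvd_mult2 by blast
      then show "\<chi> a = 0 \<and> \<chi> b = 0"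
        using \<chi>_a[OF \<chi> pi] \<chi>_b[OF \<chi> _ p(1,5)] prime_gt_0_nat[OF p(1)] by blast
    qed
  qed
  have q_i: "\<not> int q dvd i"
  proof
    assume qi: "int q dvd i"
    show False
    proof (rule generators_survive_mod[OF _ _ _ a b t gen_abt])
      show "q > 1" using prime_gt_1_nat[OF q(1)] .
      show "int q dvd m" "int q dvd n" using mn q(2,3) by auto
      fix \<chi> assume \<chi>: "\<chi> \<in> hom B (integer_mod_group q)"
      have \<chi>a: "\<chi> a = 0" using \<chi>_a[OF \<chi> qi] prime_gt_0_nat[OF q(1)] .
      have "int q dvd Y * \<chi> b"
        using lollipop_triple_mod(2)[OF group_B \<chi> abt] q(2) cong_dvd_iff dvd_mult2 by blast
      moreover have "int q dvd R * \<chi> b"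
        using lollipop_triple_mod(1)[OF group_B \<chi> abt] \<chi>a by (auto simp: cong_def dvd_eq_mod_eq_0)
      ultimately have "\<chi> b = 0" using \<chi>_b[OF \<chi> _ q(1)] q(4) by blast
      then show "\<chi> a = 0 \<and> \<chi> b = 0" using \<chi>a by simp
    qed
  qed
  define b' t' where "b' = inv\<^bsub>B\<^esub> h \<otimes>\<^bsub>B\<^esub> b \<otimes>\<^bsub>B\<^esub> h" and "t' = inv\<^bsub>B\<^esub> h \<otimes>\<^bsub>B\<^esub> t \<otimes>\<^bsub>B\<^esub> h"
  have b': "b' \<in> carrier B" and t': "t' \<in> carrier B" using b t h by (simp_all add: b'_def t'_def)
  have conj_hom: "(\<lambda>g. inv\<^bsub>B\<^esub> h \<otimes>\<^bsub>B\<^esub> g \<otimes>\<^bsub>B\<^esub> h) \<in> hom B B"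
  proof (rule homI)
    fix g g' assume g: "g \<in> carrier B" "g' \<in> carrier B"
    have "h \<otimes>\<^bsub>B\<^esub> (inv\<^bsub>B\<^esub> h \<otimes>\<^bsub>B\<^esub> (g' \<otimes>\<^bsub>B\<^esub> h)) = g' \<otimes>\<^bsub>B\<^esub> h"
      using h g by (simp flip: m_assoc)
    then show "inv\<^bsub>B\<^esub> h \<otimes>\<^bsub>B\<^esub> (g \<otimes>\<^bsub>B\<^esub> g') \<otimes>\<^bsub>B\<^esub> h =
        inv\<^bsub>B\<^esub> h \<otimes>\<^bsub>B\<^esub> g \<otimes>\<^bsub>B\<^esub> h \<otimes>\<^bsub>B\<^esub> (inv\<^bsub>B\<^esub> h \<otimes>\<^bsub>B\<^esub> g' \<otimes>\<^bsub>B\<^esub> h)"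
      using h g by (simp add: m_assoc)
  qed (use h in simp)
  have "inv\<^bsub>B\<^esub> h \<otimes>\<^bsub>B\<^esub> a \<otimes>\<^bsub>B\<^esub> h = \<alpha> [^]\<^bsub>B\<^esub> i"
  proof -
    have "a \<otimes>\<^bsub>B\<^esub> h = h \<otimes>\<^bsub>B\<^esub> \<alpha> [^]\<^bsub>B\<^esub> i" using h by (simp add: a_eq m_assoc)
    then have "inv\<^bsub>B\<^esub> h \<otimes>\<^bsub>B\<^esub> (a \<otimes>\<^bsub>B\<^esub> h) = \<alpha> [^]\<^bsub>B\<^esub> i" using h by (simp flip: m_assoc)
    then show ?thesis using h a by (simp add: m_assoc)
  qed
  then have "lollipop_triple B Q R X Y (\<alpha> [^]\<^bsub>B\<^esub> i) b' t'"
    using lollipop_triple_hom[OF group_B group_B conj_hom abt] by (simp add: b'_def t'_def)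
  then have ab': "\<alpha> [^]\<^bsub>B\<^esub> (i * Q) = b' [^]\<^bsub>B\<^esub> R"
    and tb': "t' \<otimes>\<^bsub>B\<^esub> b' [^]\<^bsub>B\<^esub> X = b' [^]\<^bsub>B\<^esub> Y \<otimes>\<^bsub>B\<^esub> t'"
    using b' t' conj_eq_iff[of t' "b' [^]\<^bsub>B\<^esub> X" "b' [^]\<^bsub>B\<^esub> Y"]
    by (simp_all add: lollipop_triple_def int_pow_pow \<alpha>)
  \<comment> \<open>Hence \<open>\<alpha>\<^bsup>iQ\<^esup>\<close> fixes only one vertex, and its centralizer lies in the powers of \<open>\<alpha>\<close>.\<close>
  have iX: "\<not> Q * X dvd i * Q" and iY: "\<not> Q * Y dvd i * Q"
    using q_i q(2) p_i p(4) Q0 by (auto simp: mult.commute[of i] dest: dvd_trans)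
  have "b' \<otimes>\<^bsub>B\<^esub> \<alpha> [^]\<^bsub>B\<^esub> (i * Q) = \<alpha> [^]\<^bsub>B\<^esub> (i * Q) \<otimes>\<^bsub>B\<^esub> b'"
    unfolding ab' using b' int_pow_mult[of b' 1 R] int_pow_mult[of b' R 1] by (simp add: add.commute)
  then obtain j where j: "b' = \<alpha> [^]\<^bsub>B\<^esub> (j :: int)"
    using mem_\<alpha>_if_conj_\<alpha>[OF b'] iX iY mn by metis
  have eq: "i * Q = j * R"
    using ab' by (intro \<alpha>_pow_inj) (simp add: j int_pow_pow \<alpha>)
  \<comment> \<open>Since \<open>p\<close> divides \<open>R\<close> but not \<open>i\<close>, \<open>iQ = jR\<close> gives \<open>j\<close> fewer factors \<open>p\<close> than \<open>Q\<close> has.\<close>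
  have jX: "\<not> Q dvd j * X"
  proof
    assume Qj: "Q dvd j * X"
    obtain e Q' where Q': "Q = int p ^ e * Q'" "\<not> int p dvd Q'"
    proof (rule multiplicity_decompose'[OF Q0])
      show "\<not> is_unit (int p)" using prime_gt_1_nat[OF p(1)] by simp
    qed blast
    have "int p ^ e dvd j * X" using Qj Q'(1) by (metis dvd_mult_left)
    moreover have "coprime (int p ^ e) X"
      using prime_imp_coprime[of "int p" X] p(1,5) by simp
    ultimately have "int p ^ e dvd j" by (simp add: coprime_dvd_mult_left_iff)
    then have "int p ^ e * int p dvd j * R" using p(3) by (rule mult_dvd_mono)
    moreover have "j * R = int p ^ e * (i * Q')"
      unfolding eq[symmetric] by (simp add: Q'(1) mult_ac)
    ultimately have "int p ^ e * int p dvd int p ^ e * (i * Q')" by (simp only:)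
    moreover have "int p ^ e \<noteq> 0" using prime_gt_0_nat[OF p(1)] by simp
    ultimately have "int p dvd i * Q'" using dvd_times_left_cancel_iff by blast
    then show False using p(1) p_i Q'(2) by (simp add: prime_dvd_mult_iff)
  qed
  have "t' \<otimes>\<^bsub>B\<^esub> \<alpha> [^]\<^bsub>B\<^esub> (j * X) = \<alpha> [^]\<^bsub>B\<^esub> (j * Y) \<otimes>\<^bsub>B\<^esub> t'"
    using tb' by (simp add: j int_pow_pow \<alpha>)
  moreover have "\<not> m dvd j * X" "\<not> n dvd j * X"
    using mn jX by (auto dest: dvd_mult_left)
  ultimately obtain c where c: "t' = \<alpha> [^]\<^bsub>B\<^esub> (c :: int)"
    and tj: "t' \<otimes>\<^bsub>B\<^esub> \<alpha> [^]\<^bsub>B\<^esub> (j * X) = \<alpha> [^]\<^bsub>B\<^esub> (j * Y) \<otimes>\<^bsub>B\<^esub> t'"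
    using mem_\<alpha>_if_conj_\<alpha>[OF t'] by blast
  have "c + j * X = j * Y + c"
    using tj by (intro \<alpha>_pow_inj) (simp add: c \<alpha>_pow_add)
  then have "j = 0" using p(4,5) by auto
  then show False using jX by simp
qed

end

section \<open>The characterization\<close>

theorem theorem1p2:
  fixes Q R X Y :: int
  assumes "Q \<noteq> 0" and "R \<noteq> 0" and "X \<noteq> 0" and "Y \<noteq> 0"
    and "two_generated (lollipop_group Q R X Y)"
  shows "(\<exists>f. f \<in> epi (lollipop_group Q R X Y) (BS (Q * X) (Q * Y))) \<longleftrightarrow>
         gcd X (Q * Y) = 1 \<or> gcd Y (Q * X) = 1 \<or> gcd Q R = 1"
proof -
  interpret bs_forms "Q * X" "Q * Y"
    by unfold_locales (use assms in simp_all)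
  have prime_ex: "\<exists>p :: nat. prime p \<and> int p dvd x \<and> int p dvd y" if "gcd x y \<noteq> 1" "x \<noteq> 0" for x y :: int
  proof -
    have "gcd x y \<noteq> 0" "\<not> is_unit (gcd x y)"
      using that by (simp_all add: is_unit_gcd coprime_iff_gcd_eq_1)
    then obtain p where "prime p" "p dvd gcd x y" using prime_divisor_exists by blast
    then show ?thesis by (intro exI[of _ "nat p"]) (auto simp: prime_ge_0_int)
  qed
  have no_common_factor: "\<not> (int q dvd R \<and> int q dvd X \<and> int q dvd Y)" if "prime p" "int p dvd Q" "prime q" for p q :: nat
    using not_two_generated_if_common_factor[OF that] assms(5) by blast
  have divides_X_or_Y: "int p dvd X \<or> int p dvd Y" if "prime p" "int p dvd Q" "int p dvd R" for p :: nat
    using not_two_generated_if_no_divisor[OF that] assms(5) by blast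
  have divides_X_or_Y_int: "p dvd X \<or> p dvd Y" if "prime p" "p dvd Q" "p dvd R" for p :: int
    using divides_X_or_Y[of "nat p"] that by (simp add: prime_ge_0_int)
  show ?thesis
    unfolding lollipop_epi_iff[OF group_B]
  proof
    assume "\<exists>a b t. lollipop_triple B Q R X Y a b t \<and> generate B {a, b, t} = carrier B"
    then obtain a b t where abt: "lollipop_triple B Q R X Y a b t" "generate B {a, b, t} = carrier B"
      by blast
    show "gcd X (Q * Y) = 1 \<or> gcd Y (Q * X) = 1 \<or> gcd Q R = 1"
    proof (rule ccontr)
      assume "\<not> ?thesis"
      then have ne: "gcd X (Q * Y) \<noteq> 1" "gcd Y (Q * X) \<noteq> 1" "gcd Q R \<noteq> 1" by auto
      obtain p where p: "prime p" "int p dvd Q" "int p dvd R" using prime_ex[OF ne(3) assms(1)] by blast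
      obtain q where q: "prime q" "int q dvd X" "int q dvd Q * Y" using prime_ex[OF ne(1) assms(3)] by blast
      obtain q' where q': "prime q'" "int q' dvd Y" "int q' dvd Q * X" using prime_ex[OF ne(2) assms(4)] by blast
      consider "int p dvd Y" "\<not> int p dvd X" | "int p dvd X" "\<not> int p dvd Y"
        using no_common_factor[OF p(1,2,1)] divides_X_or_Y[OF p] p(3) by blast
      then show False
      proof cases
        case 1
        show False
          by (rule no_generating_lollipop_triple[OF _ abt p 1 q])
            (use no_common_factor[OF p(1,2) q(1)] q(2) in auto)
      next
        case 2
        have c: "a \<in> carrier B" "b \<in> carrier B" "t \<in> carrier B"
          using abt(1) by (auto simp: lollipop_triple_def)
        have gen': "generate B {a, b, inv\<^bsub>B\<^esub> t} = carrier B"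
          using generate_inv_last[OF c] abt(2) by simp
        show False
          by (rule no_generating_lollipop_triple[OF _ lollipop_triple_swap[OF abt(1)] gen' p 2 q'])
            (use no_common_factor[OF p(1,2) q'(1)] q'(2) in auto)
      qed
    qed
  next
    assume "gcd X (Q * Y) = 1 \<or> gcd Y (Q * X) = 1 \<or> gcd Q R = 1"
    then consider "coprime X (Q * Y)" | "coprime Y (Q * X)" | "coprime Q R"
      by (auto simp: coprime_iff_gcd_eq_1)
    then show "\<exists>a b t. lollipop_triple B Q R X Y a b t \<and> generate B {a, b, t} = carrier B"
    proof cases
      case 1
      have "p dvd Y" if "prime p" "p dvd Q" "p dvd R" for p
        using divides_X_or_Y_int[OF that] 1 that coprime_common_divisor[of X "Q * Y" p] by (auto simp: not_prime_unit)
      then show ?thesis by (intro lollipop_triple_if_coprime_X 1 assms(2)) simp_all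
    next
      case 2
      interpret swap: bs_relation B \<alpha> "inv\<^bsub>B\<^esub> \<tau>" "Q * Y" "Q * X"
      proof
        show "\<alpha> \<in> carrier B" "inv\<^bsub>B\<^esub> \<tau> \<in> carrier B" using \<alpha> \<tau> by simp_all
        show "generate B {\<alpha>, inv\<^bsub>B\<^esub> \<tau>} = carrier B"
          using generate_inv_last[of \<alpha> \<alpha> \<tau>] gen \<alpha> \<tau> by simp
        show "inv\<^bsub>B\<^esub> \<tau> \<otimes>\<^bsub>B\<^esub> \<alpha> [^]\<^bsub>B\<^esub> (Q * Y) = \<alpha> [^]\<^bsub>B\<^esub> (Q * X) \<otimes>\<^bsub>B\<^esub> inv\<^bsub>B\<^esub> \<tau>"
          using stable_\<alpha>_pow[of False 1] by (simp add: stable_def modulus_def)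
      qed
      have "p dvd X" if "prime p" "p dvd Q" "p dvd R" for p
        using divides_X_or_Y_int[OF that] 2 that coprime_common_divisor[of Y "Q * X" p] by (auto simp: not_prime_unit)
      then obtain a b t where abt: "lollipop_triple B Q R Y X a b t" "generate B {a, b, t} = carrier B"
        using swap.lollipop_triple_if_coprime_X[of Q Y X R] 2 assms(2) by auto
      have c: "a \<in> carrier B" "b \<in> carrier B" "t \<in> carrier B"
        using abt(1) by (auto simp: lollipop_triple_def)
      show ?thesis
        using lollipop_triple_swap[OF abt(1)] generate_inv_last[OF c] abt(2) by metis
    next
      case 3
      then show ?thesis by (intro lollipop_triple_if_coprime_QR) simp_all
    qed
  qed
qed

end
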